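(* Let $R$ be a ring of bounded index. If $R$ is strongly 2-nil-clean, then the matrix ring $M_n(R)$ is trinil clean for all $n\in\mathbb{N}$.
   Context: All rings are associative with identity, not necessarily commutative. $\mathbb{N}$ is the set of positive integers and $M_n(R)$ is the ring of $n\times n$ matrices over $R$. A ring $R$ is of bounded index if there exists some $k\in\mathbb{N}$ such that $x^k=0$ for all nilpotent $x\in R$. An element $e$ of a ring is a tripotent if $e^3=e$. A ring is trinil clean if every element is the sum of a tripotent and a nilpotent (no commutation required). A ring is strongly 2-nil-clean if every element is the sum of two idempotents and a nilpotent that commute with one another. *)

theory Defs
  imports "HOL-Algebra.Ring" "Jordan_Normal_Form.Matrix"
begin

(* The library matrix ring ring_mat takes its entries from a type class whose
   instances satisfy 0 ~= 1.  Here the entries come from an arbitrary ring R given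
   by a carrier, the zero ring included; the product is computed with the operations
   of R in the order A(i,k) B(k,j), since R need not be commutative. *)
definition matrix_ring :: "('a, 'b) ring_scheme \<Rightarrow> nat \<Rightarrow> 'a mat ring" where
  "matrix_ring R n =
    \<lparr>carrier = {A \<in> carrier_mat n n. \<forall>i<n. \<forall>j<n. A $$ (i, j) \<in> carrier R},
     monoid.mult = (\<lambda>A B. mat n n (\<lambda>(i, j). \<Oplus>\<^bsub>R\<^esub>k\<in>{..<n}. A $$ (i, k) \<otimes>\<^bsub>R\<^esub> B $$ (k, j))),
     one = mat n n (\<lambda>(i, j). if i = j then \<one>\<^bsub>R\<^esub> else \<zero>\<^bsub>R\<^esub>),
     zero = mat n n (\<lambda>(i, j). \<zero>\<^bsub>R\<^esub>),
     add = (\<lambda>A B. mat n n (\<lambda>(i, j). A $$ (i, j) \<oplus>\<^bsub>R\<^esub> B $$ (i, j)))\<rparr>"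

definition ring_idempotent :: "('a, 'b) ring_scheme \<Rightarrow> 'a \<Rightarrow> bool" where
  "ring_idempotent R e \<longleftrightarrow> e \<in> carrier R \<and> e [^]\<^bsub>R\<^esub> (2::nat) = e"

definition ring_tripotent :: "('a, 'b) ring_scheme \<Rightarrow> 'a \<Rightarrow> bool" where
  "ring_tripotent R e \<longleftrightarrow> e \<in> carrier R \<and> e [^]\<^bsub>R\<^esub> (3::nat) = e"

definition ring_nilpotent :: "('a, 'b) ring_scheme \<Rightarrow> 'a \<Rightarrow> bool" where
  "ring_nilpotent R x \<longleftrightarrow> x \<in> carrier R \<and> (\<exists>k::nat. 0 < k \<and> x [^]\<^bsub>R\<^esub> k = \<zero>\<^bsub>R\<^esub>)"

definition bounded_index :: "('a, 'b) ring_scheme \<Rightarrow> bool" where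
  "bounded_index R \<longleftrightarrow>
    (\<exists>k::nat. 0 < k \<and> (\<forall>x. ring_nilpotent R x \<longrightarrow> x [^]\<^bsub>R\<^esub> k = \<zero>\<^bsub>R\<^esub>))"

definition trinil_clean :: "('a, 'b) ring_scheme \<Rightarrow> bool" where
  "trinil_clean R \<longleftrightarrow>
    (\<forall>a\<in>carrier R. \<exists>e w. ring_tripotent R e \<and> ring_nilpotent R w \<and> a = e \<oplus>\<^bsub>R\<^esub> w)"

definition strongly_2_nil_clean :: "('a, 'b) ring_scheme \<Rightarrow> bool" where
  "strongly_2_nil_clean R \<longleftrightarrow>
    (\<forall>a\<in>carrier R. \<exists>e f w.
       ring_idempotent R e \<and> ring_idempotent R f \<and> ring_nilpotent R w \<and>
       e \<otimes>\<^bsub>R\<^esub> f = f \<otimes>\<^bsub>R\<^esub> e \<and> e \<otimes>\<^bsub>R\<^esub> w = w \<otimes>\<^bsub>R\<^esub> e \<and> f \<otimes>\<^bsub>R\<^esub> w = w \<otimes>\<^bsub>R\<^esub> f \<and>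
       a = e \<oplus>\<^bsub>R\<^esub> f \<oplus>\<^bsub>R\<^esub> w)"

lemma ring_matrix_ring:
  fixes R (structure)
  assumes "ring R"
  shows "ring (matrix_ring R n)"
proof -
  interpret ring R by fact
  let ?M = "matrix_ring R n"
  have carr: "A \<in> carrier ?M \<longleftrightarrow> A \<in> carrier_mat n n \<and> (\<forall>i<n. \<forall>j<n. A $$ (i, j) \<in> carrier R)" for A
    by (simp add: matrix_ring_def)
  have entry: "A $$ (i, j) \<in> carrier R" if "A \<in> carrier ?M" "i < n" "j < n" for A i j
    using that by (simp add: carr)
  have mat_eqI: "A = B"
    if "A \<in> carrier ?M" "B \<in> carrier ?M" "\<And>i j. i < n \<Longrightarrow> j < n \<Longrightarrow> A $$ (i, j) = B $$ (i, j)" for A B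
    using that by (intro eq_matI) (auto simp: carr)
  have add: "(A \<oplus>\<^bsub>?M\<^esub> B) $$ (i, j) = A $$ (i, j) \<oplus> B $$ (i, j)" if "i < n" "j < n" for A B i j
    using that by (simp add: matrix_ring_def)
  have mult: "(A \<otimes>\<^bsub>?M\<^esub> B) $$ (i, j) = (\<Oplus>k\<in>{..<n}. A $$ (i, k) \<otimes> B $$ (k, j))"
    if "i < n" "j < n" for A B i j
    using that by (simp add: matrix_ring_def)
  have one: "\<one>\<^bsub>?M\<^esub> $$ (i, j) = (if i = j then \<one> else \<zero>)" if "i < n" "j < n" for i j
    using that by (simp add: matrix_ring_def)
  have zero: "\<zero>\<^bsub>?M\<^esub> $$ (i, j) = \<zero>" if "i < n" "j < n" for i j
    using that by (simp add: matrix_ring_def)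
  have add_c: "A \<oplus>\<^bsub>?M\<^esub> B \<in> carrier ?M" if "A \<in> carrier ?M" "B \<in> carrier ?M" for A B
    using that by (simp add: matrix_ring_def)
  have mult_c: "A \<otimes>\<^bsub>?M\<^esub> B \<in> carrier ?M" if "A \<in> carrier ?M" "B \<in> carrier ?M" for A B
    using that by (auto simp: matrix_ring_def intro!: finsum_closed)
  have one_c: "\<one>\<^bsub>?M\<^esub> \<in> carrier ?M" and zero_c: "\<zero>\<^bsub>?M\<^esub> \<in> carrier ?M"
    by (simp_all add: matrix_ring_def)
  have sum_eq: "(\<Oplus>k\<in>{..<n}. f k) = (\<Oplus>k\<in>{..<n}. g k)"
    if "\<And>k. k < n \<Longrightarrow> g k \<in> carrier R" "\<And>k. k < n \<Longrightarrow> f k = g k" for f g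
    using that by (intro finsum_cong') auto
  have sum_c: "(\<Oplus>k\<in>{..<n}. f k) \<in> carrier R" if "\<And>k. k < n \<Longrightarrow> f k \<in> carrier R" for f
    using that by (intro finsum_closed) auto
  have sum_one: "(\<Oplus>k\<in>{..<n}. if i = k then f k else \<zero>) = f i"
    if "i < n" "\<And>k. k < n \<Longrightarrow> f k \<in> carrier R" for f i
    using that by (intro finsum_singleton) auto
  show ?thesis
  proof (rule ringI)
    show "abelian_group ?M"
    proof (rule abelian_groupI)
      fix A assume A: "A \<in> carrier ?M"
      let ?B = "mat n n (\<lambda>(i, j). \<ominus> A $$ (i, j))"
      have B: "?B \<in> carrier ?M"
        using A by (simp add: carr)
      have "?B \<oplus>\<^bsub>?M\<^esub> A = \<zero>\<^bsub>?M\<^esub>"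
        by (rule mat_eqI[OF add_c[OF B A] zero_c]) (use A in \<open>simp add: add zero l_neg entry\<close>)
      with B show "\<exists>B\<in>carrier ?M. B \<oplus>\<^bsub>?M\<^esub> A = \<zero>\<^bsub>?M\<^esub>" by blast
    qed (auto intro!: mat_eqI simp: add_c zero_c add zero entry a_ac)
  next
    show "Group.monoid ?M"
    proof (rule monoidI)
      fix A B C assume *: "A \<in> carrier ?M" "B \<in> carrier ?M" "C \<in> carrier ?M"
      show "A \<otimes>\<^bsub>?M\<^esub> B \<otimes>\<^bsub>?M\<^esub> C = A \<otimes>\<^bsub>?M\<^esub> (B \<otimes>\<^bsub>?M\<^esub> C)"
      proof (rule mat_eqI)
        fix i j assume ij: "i < n" "j < n"
        have "(A \<otimes>\<^bsub>?M\<^esub> B \<otimes>\<^bsub>?M\<^esub> C) $$ (i, j) =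
              (\<Oplus>k\<in>{..<n}. (A \<otimes>\<^bsub>?M\<^esub> B) $$ (i, k) \<otimes> C $$ (k, j))"
          using ij by (rule mult)
        also have "\<dots> = (\<Oplus>k\<in>{..<n}. \<Oplus>l\<in>{..<n}. A $$ (i, l) \<otimes> B $$ (l, k) \<otimes> C $$ (k, j))"
          by (rule sum_eq) (use ij * in \<open>simp_all add: mult finsum_ldistr Pi_def entry sum_c\<close>)
        also have "\<dots> = (\<Oplus>l\<in>{..<n}. \<Oplus>k\<in>{..<n}. A $$ (i, l) \<otimes> B $$ (l, k) \<otimes> C $$ (k, j))"
          using ij * by (intro finsum_finsum_swap) (simp_all add: entry)
        also have "\<dots> = (\<Oplus>l\<in>{..<n}. \<Oplus>k\<in>{..<n}. A $$ (i, l) \<otimes> (B $$ (l, k) \<otimes> C $$ (k, j)))"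
          by (intro sum_eq sum_c) (use ij * in \<open>simp_all add: entry m_assoc\<close>)
        also have "\<dots> = (\<Oplus>l\<in>{..<n}. A $$ (i, l) \<otimes> (B \<otimes>\<^bsub>?M\<^esub> C) $$ (l, j))"
          by (rule sum_eq) (use ij * in \<open>simp_all add: mult finsum_rdistr Pi_def entry sum_c\<close>)
        also have "\<dots> = (A \<otimes>\<^bsub>?M\<^esub> (B \<otimes>\<^bsub>?M\<^esub> C)) $$ (i, j)"
          using ij by (rule mult[symmetric])
        finally show "(A \<otimes>\<^bsub>?M\<^esub> B \<otimes>\<^bsub>?M\<^esub> C) $$ (i, j) = (A \<otimes>\<^bsub>?M\<^esub> (B \<otimes>\<^bsub>?M\<^esub> C)) $$ (i, j)" .
      qed (use * in \<open>simp_all add: mult_c\<close>)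
    next
      fix A assume *: "A \<in> carrier ?M"
      show "\<one>\<^bsub>?M\<^esub> \<otimes>\<^bsub>?M\<^esub> A = A"
      proof (rule mat_eqI)
        fix i j assume ij: "i < n" "j < n"
        have "(\<one>\<^bsub>?M\<^esub> \<otimes>\<^bsub>?M\<^esub> A) $$ (i, j) = (\<Oplus>k\<in>{..<n}. if i = k then A $$ (k, j) else \<zero>)"
          unfolding mult[OF ij] by (rule sum_eq) (use ij * in \<open>simp_all add: one entry\<close>)
        also have "\<dots> = A $$ (i, j)"
          by (rule sum_one) (use ij * in \<open>simp_all add: entry\<close>)
        finally show "(\<one>\<^bsub>?M\<^esub> \<otimes>\<^bsub>?M\<^esub> A) $$ (i, j) = A $$ (i, j)" .
      qed (use * in \<open>simp_all add: mult_c one_c\<close>)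
      show "A \<otimes>\<^bsub>?M\<^esub> \<one>\<^bsub>?M\<^esub> = A"
      proof (rule mat_eqI)
        fix i j assume ij: "i < n" "j < n"
        have "(A \<otimes>\<^bsub>?M\<^esub> \<one>\<^bsub>?M\<^esub>) $$ (i, j) = (\<Oplus>k\<in>{..<n}. if j = k then A $$ (i, k) else \<zero>)"
          unfolding mult[OF ij] by (rule sum_eq) (use ij * in \<open>auto simp: one entry\<close>)
        also have "\<dots> = A $$ (i, j)"
          by (rule sum_one) (use ij * in \<open>simp_all add: entry\<close>)
        finally show "(A \<otimes>\<^bsub>?M\<^esub> \<one>\<^bsub>?M\<^esub>) $$ (i, j) = A $$ (i, j)" .
      qed (use * in \<open>simp_all add: mult_c one_c\<close>)
    qed (simp_all add: mult_c one_c)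
  next
    fix A B C assume *: "A \<in> carrier ?M" "B \<in> carrier ?M" "C \<in> carrier ?M"
    show "(A \<oplus>\<^bsub>?M\<^esub> B) \<otimes>\<^bsub>?M\<^esub> C = A \<otimes>\<^bsub>?M\<^esub> C \<oplus>\<^bsub>?M\<^esub> B \<otimes>\<^bsub>?M\<^esub> C"
    proof (rule mat_eqI)
      fix i j assume ij: "i < n" "j < n"
      have "((A \<oplus>\<^bsub>?M\<^esub> B) \<otimes>\<^bsub>?M\<^esub> C) $$ (i, j) =
            (\<Oplus>k\<in>{..<n}. A $$ (i, k) \<otimes> C $$ (k, j) \<oplus> B $$ (i, k) \<otimes> C $$ (k, j))"
        unfolding mult[OF ij] by (rule sum_eq) (use ij * in \<open>simp_all add: add entry l_distr\<close>)
      also have "\<dots> = (A \<otimes>\<^bsub>?M\<^esub> C \<oplus>\<^bsub>?M\<^esub> B \<otimes>\<^bsub>?M\<^esub> C) $$ (i, j)"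
        unfolding add[OF ij] mult[OF ij]
        by (rule finsum_addf) (use ij * in \<open>simp_all add: entry\<close>)
      finally show "((A \<oplus>\<^bsub>?M\<^esub> B) \<otimes>\<^bsub>?M\<^esub> C) $$ (i, j) =
        (A \<otimes>\<^bsub>?M\<^esub> C \<oplus>\<^bsub>?M\<^esub> B \<otimes>\<^bsub>?M\<^esub> C) $$ (i, j)" .
    qed (use * in \<open>simp_all add: mult_c add_c\<close>)
    show "C \<otimes>\<^bsub>?M\<^esub> (A \<oplus>\<^bsub>?M\<^esub> B) = C \<otimes>\<^bsub>?M\<^esub> A \<oplus>\<^bsub>?M\<^esub> C \<otimes>\<^bsub>?M\<^esub> B"
    proof (rule mat_eqI)
      fix i j assume ij: "i < n" "j < n"
      have "(C \<otimes>\<^bsub>?M\<^esub> (A \<oplus>\<^bsub>?M\<^esub> B)) $$ (i, j) =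
            (\<Oplus>k\<in>{..<n}. C $$ (i, k) \<otimes> A $$ (k, j) \<oplus> C $$ (i, k) \<otimes> B $$ (k, j))"
        unfolding mult[OF ij] by (rule sum_eq) (use ij * in \<open>simp_all add: add entry r_distr\<close>)
      also have "\<dots> = (C \<otimes>\<^bsub>?M\<^esub> A \<oplus>\<^bsub>?M\<^esub> C \<otimes>\<^bsub>?M\<^esub> B) $$ (i, j)"
        unfolding add[OF ij] mult[OF ij]
        by (rule finsum_addf) (use ij * in \<open>simp_all add: entry\<close>)
      finally show "(C \<otimes>\<^bsub>?M\<^esub> (A \<oplus>\<^bsub>?M\<^esub> B)) $$ (i, j) =
        (C \<otimes>\<^bsub>?M\<^esub> A \<oplus>\<^bsub>?M\<^esub> C \<otimes>\<^bsub>?M\<^esub> B) $$ (i, j)" .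
    qed (use * in \<open>simp_all add: mult_c add_c\<close>)
  qed
qed

end

theory Submission
  imports Defs "HOL-Algebra.QuotRing" "HOL-Algebra.Ring_Divisibility"
    "HOL-Library.Z2" "HOL-Computational_Algebra.Polynomial"
begin

text \<open>
  In a strongly 2-nil-clean ring the element $a^3 - a$ is nilpotent for every $a$: this follows from
  the decomposition of $a + 1$ (\<open>strongly_2_nil_clean_cube\<close>).

  This excludes $2 \<times> 2$ matrix units, because the Fibonacci matrix $u$ satisfies $u^3 - u = u^2$ and is
  invertible.  Consequently the nilpotent elements form an ideal $J$ (\<open>nil_radical_eq_nilpotents\<close>), and $R / J$ satisfies
  $a^3 = a$.  Idempotents of such a ring are central, and $6 = 0$ in it, so the finitely many entries of a
  matrix over $R / J$ generate a product of copies of the fields with two and with three elements.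
  Over these fields every matrix is similar to a block triangular one with companion matrices on the
  diagonal, and a companion matrix $C$ can be written explicitly as $C = P - Q + W$ with orthogonal idempotents $P$, $Q$
  and a nilpotent $W$ (\<open>cyclic_block_decomposition\<close>).  Hence every matrix over $R / J$ has this form (\<open>cube_eq_matrix_decomposition\<close>).

  It remains to lift the decomposition along the surjection from $M_n(R)$ to $M_n(R / J)$, whose kernel
  is $M_n(J)$.  Here the bounded index enters: by Levitzki's theorem a nil ideal of bounded index
  is locally nilpotent (\<open>nil_bounded_index_locally_nilpotent\<close>), so that $M_n(J)$ is nil.  Modulo a nil ideal orthogonal
  idempotents lift to orthogonal idempotents, whose difference is a tripotent, and everything that
  maps to a nilpotent element is nilpotent (\<open>tripotent_plus_nilpotent_lift\<close>).
\<close>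

section \<open>Nilpotent elements and idempotent lifting\<close>

context ring
begin

lemma nilpotentI: "x \<in> carrier R \<Longrightarrow> x [^] (k::nat) = \<zero> \<Longrightarrow> ring_nilpotent R x"
  unfolding ring_nilpotent_def
  by (intro conjI exI[of _ "Suc k"]) auto

lemma nilpotentE:
  assumes "ring_nilpotent R x"
  obtains k :: nat where "x \<in> carrier R" "x [^] k = \<zero>"
  using assms unfolding ring_nilpotent_def by auto

lemma nilpotent_mult_commuting:
  assumes "ring_nilpotent R x" "y \<in> carrier R" "x \<otimes> y = y \<otimes> x"
  shows "ring_nilpotent R (x \<otimes> y)"
proof -
  obtain k :: nat where "x \<in> carrier R" "x [^] k = \<zero>"
    using assms(1) by (rule nilpotentE)
  then have "(x \<otimes> y) [^] k = \<zero>"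
    using assms by (simp add: pow_mult_distrib)
  then show ?thesis
    using \<open>x \<in> carrier R\<close> assms(2) by (intro nilpotentI) auto
qed

lemma nilpotent_mult_swap:
  assumes "a \<in> carrier R" "b \<in> carrier R" "ring_nilpotent R (a \<otimes> b)"
  shows "ring_nilpotent R (b \<otimes> a)"
proof -
  obtain k :: nat where k: "(a \<otimes> b) [^] k = \<zero>"
    using assms(3) by (rule nilpotentE)
  have *: "(b \<otimes> a) [^] Suc m = b \<otimes> (a \<otimes> b) [^] m \<otimes> a" for m :: nat
  proof (induction m)
    case (Suc m)
    have "(b \<otimes> a) [^] Suc (Suc m) = b \<otimes> (a \<otimes> b) [^] m \<otimes> a \<otimes> (b \<otimes> a)"
      using Suc by simp
    then show ?case using assms by (simp add: m_assoc)
  qed (use assms in simp)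
  have "(b \<otimes> a) [^] Suc k = \<zero>"
    unfolding * k using assms by simp
  then show ?thesis using assms by (intro nilpotentI[of _ "Suc k"]) auto
qed

lemma nilpotent_of_power:
  assumes "x \<in> carrier R" "ring_nilpotent R (x [^] (m::nat))"
  shows "ring_nilpotent R x"
proof -
  obtain k :: nat where "(x [^] m) [^] k = \<zero>" using assms(2) by (rule nilpotentE)
  then show ?thesis using assms(1) by (intro nilpotentI[of _ "m * k"]) (auto simp: nat_pow_pow)
qed

text \<open>
  The geometric series: its partial sums $y$ satisfy $(1 - x) y = y (1 - x) = 1 - x^m$.
\<close>
lemma minus_one_nilpotent_inverse:
  assumes "ring_nilpotent R x"
  obtains y where "y \<in> carrier R" "(\<one> \<ominus> x) \<otimes> y = \<one>" "y \<otimes> (\<one> \<ominus> x) = \<one>"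
proof -
  obtain k :: nat where x: "x \<in> carrier R" "x [^] k = \<zero>"
    using assms by (rule nilpotentE)
  have "\<exists>y\<in>carrier R. (\<one> \<ominus> x) \<otimes> y = \<one> \<ominus> x [^] m \<and> y \<otimes> (\<one> \<ominus> x) = \<one> \<ominus> x [^] m" for m :: nat
  proof (induction m)
    case 0
    show ?case using x by (intro bexI[of _ "\<zero>"]) (auto simp: r_neg minus_eq)
  next
    case (Suc m)
    then obtain y where y: "y \<in> carrier R" "(\<one> \<ominus> x) \<otimes> y = \<one> \<ominus> x [^] m" "y \<otimes> (\<one> \<ominus> x) = \<one> \<ominus> x [^] m"
      by blast
    let ?p = "x [^] m"
    have p: "?p \<in> carrier R" "x \<otimes> ?p = ?p \<otimes> x"
      using x group_commutes_pow[of x x m] by auto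
    have tel: "(\<one> \<ominus> ?p) \<oplus> (?p \<ominus> ?p \<otimes> x) = \<one> \<ominus> ?p \<otimes> x"
      using x p by (simp add: minus_eq a_assoc r_neg1)
    have "(\<one> \<ominus> x) \<otimes> (y \<oplus> ?p) = (\<one> \<ominus> ?p) \<oplus> (?p \<ominus> ?p \<otimes> x)"
      using x p y by (simp only: r_distr minus_closed one_closed) (simp add: minus_eq l_distr l_minus)
    moreover have "(y \<oplus> ?p) \<otimes> (\<one> \<ominus> x) = (\<one> \<ominus> ?p) \<oplus> (?p \<ominus> ?p \<otimes> x)"
      using x p y by (simp only: l_distr minus_closed one_closed) (simp add: minus_eq r_distr r_minus)
    ultimately show ?case
      using x p y tel by (intro bexI[of _ "y \<oplus> ?p"]) auto
  qed
  from this[of k] show ?thesis using that x by (auto simp: minus_eq)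
qed


text \<open>
  Newton iteration for the equation $x^2 = x$.  With $c = 1 - a$, the element
  $x = 3 a^2 - 2 a^3 = a^2 (a + 3 c)$ differs from $a$ by a multiple of $a c$, and its own defect
  $x (1 - x)$ is a multiple of $(a c)^2$, so each step halves the nilpotency index of the defect.
  Both $s$ and $d$ are polynomials in $a$; the clause about $z$ records the one consequence of this
  that is used, and in this form it is inherited from $x$ by $a$ in the induction.
\<close>
lemma idempotent_lifting:
  assumes "a \<in> carrier R" "c \<in> carrier R" "a \<oplus> c = \<one>" "(a \<otimes> c) [^] (k::nat) = \<zero>"
  shows "\<exists>s\<in>carrier R. \<exists>d\<in>carrier R.
           (\<forall>z\<in>carrier R. z \<otimes> a = a \<otimes> z \<longrightarrow> z \<otimes> s = s \<otimes> z \<and> z \<otimes> d = d \<otimes> z) \<and>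
           (a \<otimes> s) \<otimes> (a \<otimes> s) = a \<otimes> s \<and> a = a \<otimes> s \<oplus> (a \<otimes> c) \<otimes> d"
  using assms
proof (induction k arbitrary: a c rule: less_induct)
  case (less k)
  note [simp] = less.prems(1,2)
  have ca: "c \<otimes> a = a \<otimes> c"
  proof -
    have "a \<otimes> (a \<oplus> c) = (a \<oplus> c) \<otimes> a" using less.prems by simp
    then show ?thesis by (simp add: l_distr r_distr)
  qed
  have ca': "c \<otimes> (a \<otimes> z) = a \<otimes> (c \<otimes> z)" if "z \<in> carrier R" for z
    using that ca m_assoc[of c a z] m_assoc[of a c z] by simp
  note norm = l_distr r_distr m_assoc a_assoc a_comm a_lcomm ca ca'
  show ?case
  proof (cases "k \<le> 1")
    case True
    then have "a \<otimes> c = \<zero>"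
    proof (cases "k = 0")
      case True
      then have "\<one> = \<zero>" using less.prems by simp
      then show ?thesis by (metis less.prems(1,2) m_closed r_null r_one)
    qed (use less.prems in \<open>auto simp: le_Suc_eq\<close>)
    moreover from this have "a \<otimes> a = a"
      using less.prems(3) r_distr[of a c a] by simp
    ultimately show ?thesis
      by (intro bexI[of _ \<one>]) auto
  next
    case False
    \<comment> \<open>Written homogeneously in $a$ and $c$, with $1 = a + c$, the identities below contain no signs.\<close>
    define t where "t = a \<oplus> (c \<oplus> (c \<oplus> c))"
    define t' where "t' = c \<oplus> (a \<oplus> (a \<oplus> a))"
    define x where "x = a \<otimes> (a \<otimes> t)"
    define y where "y = c \<otimes> (c \<otimes> t')"
    have [simp]: "t \<in> carrier R" "t' \<in> carrier R" "x \<in> carrier R" "y \<in> carrier R"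
      by (auto simp: t_def t'_def x_def y_def)
    have "x \<oplus> y = (a \<oplus> c) \<otimes> ((a \<oplus> c) \<otimes> (a \<oplus> c))"
      by (simp add: x_def y_def t_def t'_def norm)
    then have xy1: "x \<oplus> y = \<one>" by (simp add: less.prems(3))
    have xy: "x \<otimes> y = (a \<otimes> c) \<otimes> ((a \<otimes> c) \<otimes> (t \<otimes> t'))"
      by (simp add: x_def y_def t_def t'_def norm)
    have xy': "x \<otimes> y = ((a \<otimes> c) \<otimes> (a \<otimes> c)) \<otimes> (t \<otimes> t')"
      by (simp add: xy m_assoc)
    define j where "j = (k + 1) div 2"
    have j: "j < k" "k \<le> 2 * j" using False by (auto simp: j_def)
    have "(x \<otimes> y) [^] j = ((a \<otimes> c) \<otimes> (a \<otimes> c)) [^] j \<otimes> (t \<otimes> t') [^] j"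
      unfolding xy' by (rule pow_mult_distrib) (simp_all add: t_def t'_def norm)
    also have "((a \<otimes> c) \<otimes> (a \<otimes> c)) [^] j = (a \<otimes> c) [^] k \<otimes> (a \<otimes> c) [^] (2 * j - k)"
      using j by (simp add: pow_mult_distrib nat_pow_mult mult_2)
    finally have "(x \<otimes> y) [^] j = \<zero>" by (simp add: less.prems(4))
    from less.IH[OF j(1) _ _ xy1 this] obtain s d where
      sd: "s \<in> carrier R" "d \<in> carrier R"
      and com: "\<And>z. z \<in> carrier R \<Longrightarrow> z \<otimes> x = x \<otimes> z \<Longrightarrow> z \<otimes> s = s \<otimes> z \<and> z \<otimes> d = d \<otimes> z"
      and idem: "(x \<otimes> s) \<otimes> (x \<otimes> s) = x \<otimes> s" and x: "x = x \<otimes> s \<oplus> (x \<otimes> y) \<otimes> d"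
      by auto
    note [simp] = sd
    define s' where "s' = (a \<otimes> t) \<otimes> s"
    define d' where "d' = ((a \<otimes> c) \<otimes> (t \<otimes> t')) \<otimes> d \<oplus> (c \<ominus> a)"
    have s'd': "s' \<in> carrier R" "d' \<in> carrier R" by (auto simp: s'_def d'_def)
    have xs: "x \<otimes> s = a \<otimes> s'" by (simp add: x_def s'_def m_assoc)
    have "a \<otimes> ((a \<oplus> c) \<otimes> (a \<oplus> c)) \<oplus> (a \<otimes> c) \<otimes> a = x \<oplus> (a \<otimes> c) \<otimes> c"
      by (simp add: x_def t_def norm)
    \<comment> \<open>This is the identity $a = x + a c (c - a)$ without its negative term.\<close>
    then have "a \<oplus> (a \<otimes> c) \<otimes> a = x \<oplus> (a \<otimes> c) \<otimes> c" by (simp add: less.prems(3))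
    then have "a = (x \<oplus> (a \<otimes> c) \<otimes> c) \<ominus> (a \<otimes> c) \<otimes> a"
      by (metis add.inv_solve_right' less.prems(1,2) m_closed minus_eq \<open>x \<in> carrier R\<close> a_closed)
    also have "\<dots> = x \<oplus> (a \<otimes> c) \<otimes> (c \<ominus> a)"
      by (simp add: minus_eq r_distr r_minus a_assoc m_assoc)
    also have "\<dots> = (a \<otimes> s' \<oplus> (x \<otimes> y) \<otimes> d) \<oplus> (a \<otimes> c) \<otimes> (c \<ominus> a)"
      using x xs by simp
    also have "\<dots> = a \<otimes> s' \<oplus> (a \<otimes> c) \<otimes> d'"
      using s'd' by (simp add: d'_def r_distr a_assoc xy m_assoc)
    finally have a: "a = a \<otimes> s' \<oplus> (a \<otimes> c) \<otimes> d'" .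
    have "z \<otimes> s' = s' \<otimes> z \<and> z \<otimes> d' = d' \<otimes> z" if z: "z \<in> carrier R" "z \<otimes> a = a \<otimes> z" for z
    proof -
      note [simp] = z(1)
      have "z \<otimes> (a \<oplus> c) = (a \<oplus> c) \<otimes> z" using less.prems(3) by simp
      then have zc: "z \<otimes> c = c \<otimes> z" using z by (simp add: l_distr r_distr)
      have comm_mult: "z \<otimes> (u \<otimes> v) = (u \<otimes> v) \<otimes> z"
        if "z \<otimes> u = u \<otimes> z" "z \<otimes> v = v \<otimes> z" "u \<in> carrier R" "v \<in> carrier R" for u v
        using that by (metis m_assoc z(1))
      have zt: "z \<otimes> t = t \<otimes> z" "z \<otimes> t' = t' \<otimes> z"
        by (simp_all add: t_def t'_def l_distr r_distr z zc)
      have "z \<otimes> x = x \<otimes> z" unfolding x_def by (intro comm_mult zt z(2)) auto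
      with com[OF z(1)] have zs: "z \<otimes> s = s \<otimes> z" "z \<otimes> d = d \<otimes> z" by auto
      have "z \<otimes> s' = s' \<otimes> z" unfolding s'_def by (intro comm_mult zt z(2) zs) auto
      moreover have "z \<otimes> (((a \<otimes> c) \<otimes> (t \<otimes> t')) \<otimes> d) = (((a \<otimes> c) \<otimes> (t \<otimes> t')) \<otimes> d) \<otimes> z"
        by (intro comm_mult zt z(2) zs zc) auto
      moreover have "z \<otimes> (c \<ominus> a) = (c \<ominus> a) \<otimes> z"
        by (simp add: minus_eq l_distr r_distr l_minus r_minus z zc)
      ultimately show ?thesis
        by (simp add: d'_def r_distr l_distr)
    qed
    with a s'd' xs idem show ?thesis by (metis (no_types, lifting))
  qed
qed

end

section \<open>Rings in which $a^3 - a$ is always nilpotent\<close>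

context ring
begin

text \<open>
  The elements $xy, x, y, yx$ multiply like the matrix units $E_{11}, E_{12}, E_{21}, E_{22}$, and
  $u = xy + x + y$ is the Fibonacci matrix with rows $(1, 1)$ and $(1, 0)$.  It satisfies
  $u^2 = u + g$, where $g = xy + yx$ is the identity of the corner.  Hence $u^3 - u = u^2$, although
  $u$ is invertible in the corner; so $u^2$ can be nilpotent only if the corner vanishes.
\<close>
lemma no_matrix_units:
  assumes cube: "\<And>a. a \<in> carrier R \<Longrightarrow> ring_nilpotent R (a \<otimes> a \<otimes> a \<ominus> a)"
    and [simp]: "x \<in> carrier R" "y \<in> carrier R"
    and xx: "x \<otimes> x = \<zero>" and yy: "y \<otimes> y = \<zero>"
    and xyx: "x \<otimes> (y \<otimes> x) = x" and yxy: "y \<otimes> (x \<otimes> y) = y"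
  shows "x = \<zero>"
proof -
  have xyx': "x \<otimes> y \<otimes> x = x" and yxy': "y \<otimes> x \<otimes> y = y"
    using xyx yxy by (simp_all add: m_assoc)
  have rules: "x \<otimes> (x \<otimes> z) = \<zero>" "y \<otimes> (y \<otimes> z) = \<zero>"
    "x \<otimes> (y \<otimes> (x \<otimes> z)) = x \<otimes> z" "y \<otimes> (x \<otimes> (y \<otimes> z)) = y \<otimes> z" if "z \<in> carrier R" for z
    using that xyx' yxy' by (simp_all add: xx yy flip: m_assoc)
  note norm = l_distr r_distr m_assoc a_assoc a_comm a_lcomm rules xx yy xyx yxy
  define u where "u = (x \<otimes> y \<oplus> x) \<oplus> y"
  define g where "g = x \<otimes> y \<oplus> y \<otimes> x"
  have [simp]: "u \<in> carrier R" "g \<in> carrier R" by (simp_all add: u_def g_def)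
  have uu: "u \<otimes> u = u \<oplus> g" by (simp add: u_def g_def norm)
  have gu: "g \<otimes> u = u" by (simp add: u_def g_def norm)
  have "u \<otimes> u \<otimes> u = u \<otimes> u \<oplus> u"
    by (simp add: uu l_distr gu)
  then have "u \<otimes> u \<otimes> u \<ominus> u = u \<otimes> u"
    by (simp add: minus_eq a_assoc r_neg)
  then have "ring_nilpotent R (u [^] (2::nat))"
    using cube[of u] by (simp add: numeral_2_eq_2)
  then obtain k :: nat where k: "u [^] k = \<zero>"
    using nilpotent_of_power[of u 2] by (auto elim: nilpotentE)
  \<comment> \<open>The relation $u^3 = u^2 + u$ lowers a vanishing power of $u$ by one.\<close>
  have "u [^] Suc m = \<zero> \<Longrightarrow> u = \<zero>" for m :: nat
  proof (induction m)
    case (Suc m)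
    have "u [^] m \<otimes> u \<otimes> u \<otimes> u = u [^] m \<otimes> u \<otimes> u \<oplus> u [^] m \<otimes> u"
      by (simp add: m_assoc uu l_distr r_distr gu)
    with Suc show ?case by simp
  qed simp
  from this[of k] k have "u = \<zero>" by simp
  with uu have "g = \<zero>" by simp
  have "x = x \<otimes> g" by (simp add: g_def norm)
  then show ?thesis by (simp add: \<open>g = \<zero>\<close>)
qed

text \<open>
  If $a = x r$ were not nilpotent, then neither would be $b = a^2$, which is idempotent up to a
  nilpotent element.  Its lift $e$ is then a nonzero idempotent in $x R$, say $e = x y$ with
  $y e = y$.  Together with $x^2 = 0$ this produces a system of $2 \<times> 2$ matrix units, which does
  not exist.
\<close>
lemma square_zero_mult_nilpotent:
  assumes cube: "\<And>a. a \<in> carrier R \<Longrightarrow> ring_nilpotent R (a \<otimes> a \<otimes> a \<ominus> a)"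
    and [simp]: "x \<in> carrier R" "r \<in> carrier R" and xx: "x \<otimes> x = \<zero>"
  shows "ring_nilpotent R (x \<otimes> r)"
proof -
  define a where "a = x \<otimes> r"
  define b where "b = a \<otimes> a"
  define c where "c = \<one> \<ominus> b"
  have [simp]: "a \<in> carrier R" "b \<in> carrier R" "c \<in> carrier R"
    by (simp_all add: a_def b_def c_def)
  have bc: "b \<oplus> c = \<one>" by (simp add: c_def minus_eq a_lcomm[of b \<one>] r_neg)
  have "b \<otimes> c = (a \<otimes> a \<otimes> a \<ominus> a) \<otimes> \<ominus> a"
    by (simp add: c_def b_def minus_eq r_distr l_distr r_minus l_minus m_assoc minus_add a_comm)
  moreover have "ring_nilpotent R ((a \<otimes> a \<otimes> a \<ominus> a) \<otimes> \<ominus> a)"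
    by (intro nilpotent_mult_commuting cube)
       (simp_all add: minus_eq r_distr l_distr r_minus l_minus m_assoc minus_add)
  ultimately obtain k :: nat where k: "(b \<otimes> c) [^] k = \<zero>"
    by (metis nilpotentE)
  obtain s d where [simp]: "s \<in> carrier R" "d \<in> carrier R"
    and com: "\<And>z. z \<in> carrier R \<Longrightarrow> z \<otimes> b = b \<otimes> z \<Longrightarrow> z \<otimes> d = d \<otimes> z"
    and idem: "(b \<otimes> s) \<otimes> (b \<otimes> s) = b \<otimes> s" and b: "b = b \<otimes> s \<oplus> (b \<otimes> c) \<otimes> d"
    using idempotent_lifting[OF _ _ bc k] by auto
  define e where "e = b \<otimes> s"
  define y where "y = (r \<otimes> (a \<otimes> s)) \<otimes> e"
  have [simp]: "e \<in> carrier R" "y \<in> carrier R" by (simp_all add: e_def y_def)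
  have ee: "e \<otimes> e = e" using idem by (simp add: e_def)
  have "x \<otimes> (r \<otimes> (a \<otimes> s)) = e" by (simp add: e_def b_def a_def m_assoc)
  then have xy: "x \<otimes> y = e" using ee m_assoc[of x "r \<otimes> (a \<otimes> s)" e] by (simp add: y_def)
  have ye: "y \<otimes> e = y" by (simp add: y_def m_assoc ee)
  have xe: "x \<otimes> e = \<zero>" using xx by (simp flip: xy m_assoc)
  have rules: "x \<otimes> (x \<otimes> z) = \<zero>" "x \<otimes> (y \<otimes> z) = e \<otimes> z" "y \<otimes> (e \<otimes> z) = y \<otimes> z"
    "e \<otimes> (e \<otimes> z) = e \<otimes> z" "x \<otimes> (e \<otimes> z) = \<zero>" if "z \<in> carrier R" for z
    using that by (simp_all add: xx xy ye ee xe flip: m_assoc)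
  note norm = l_distr r_distr m_assoc a_assoc a_comm a_lcomm minus_eq l_minus r_minus minus_add
    rules xx xy ye ee xe r_neg r_neg1 r_neg2
  \<comment> \<open>The correction term makes the second matrix unit square to zero.\<close>
  have "e \<otimes> x = \<zero>"
  proof (rule no_matrix_units[OF cube, of "e \<otimes> x" "y \<ominus> y \<otimes> (y \<otimes> x)"])
  qed (simp_all add: norm)
  then have "e = \<zero>" using ee by (simp flip: xy m_assoc)
  with b have "b = (b \<otimes> c) \<otimes> d" by (simp add: e_def)
  moreover have "(b \<otimes> c) \<otimes> d = d \<otimes> (b \<otimes> c)"
    by (rule com) (simp_all add: c_def minus_eq r_distr l_distr r_minus l_minus m_assoc)
  then have "ring_nilpotent R ((b \<otimes> c) \<otimes> d)"
    using k by (intro nilpotent_mult_commuting nilpotentI[of _ k]) auto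
  ultimately have "ring_nilpotent R (a [^] (2::nat))"
    by (simp add: numeral_2_eq_2 b_def)
  then show ?thesis using nilpotent_of_power[of a 2] by (simp add: a_def)
qed

text \<open>
  Decompose $a + 1 = e + f + w$.  Then $a = t + w$ with $t = e - (1 - f)$, a difference of commuting
  idempotents, so $t^3 = t$, and $a^3 - a$ is a multiple of $w$ by an element commuting with $w$.
\<close>
lemma strongly_2_nil_clean_cube:
  assumes "strongly_2_nil_clean R" "a \<in> carrier R"
  shows "ring_nilpotent R (a \<otimes> a \<otimes> a \<ominus> a)"
proof -
  have "a \<oplus> \<one> \<in> carrier R" using assms by simp
  then obtain e f w where ef: "ring_idempotent R e" "ring_idempotent R f"
    and w: "ring_nilpotent R w" and com: "e \<otimes> f = f \<otimes> e" "e \<otimes> w = w \<otimes> e" "f \<otimes> w = w \<otimes> f"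
    and a1: "a \<oplus> \<one> = e \<oplus> f \<oplus> w"
    using assms(1) unfolding strongly_2_nil_clean_def by metis
  have [simp]: "e \<in> carrier R" "f \<in> carrier R" "w \<in> carrier R"
    and idem: "e \<otimes> e = e" "f \<otimes> f = f"
    using ef w by (auto simp: ring_idempotent_def ring_nilpotent_def numeral_2_eq_2)
  define g where "g = \<one> \<ominus> f"
  define t where "t = e \<ominus> g"
  have [simp]: "g \<in> carrier R" "t \<in> carrier R" by (auto simp: g_def t_def)
  have g: "g \<otimes> g = g" "e \<otimes> g = g \<otimes> e" "g \<otimes> w = w \<otimes> g"
    by (simp_all add: g_def minus_eq l_distr r_distr l_minus r_minus idem com minus_add r_neg2 a_ac r_neg)
  have "a = (a \<oplus> \<one>) \<ominus> \<one>" using assms(2) by (simp add: minus_eq a_assoc r_neg)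
  also have "\<dots> = t \<oplus> w"
    by (simp add: a1 t_def g_def minus_eq minus_add a_ac)
  finally have a: "a = t \<oplus> w" .
  have ht: "e \<otimes> t = e \<ominus> e \<otimes> g" "g \<otimes> t = e \<otimes> g \<ominus> g"
    by (simp_all add: t_def minus_eq r_distr r_minus idem g)
  have "t \<otimes> t = (e \<ominus> e \<otimes> g) \<ominus> (e \<otimes> g \<ominus> g)"
    using ht by (simp add: t_def[unfolded minus_eq] minus_eq l_distr l_minus)
  define h where "h = e \<otimes> g"
  have [simp]: "h \<in> carrier R" by (simp add: h_def)
  have h: "e \<otimes> h = h" "g \<otimes> h = h" "g \<otimes> e = h"
    by (simp_all add: h_def g idem flip: m_assoc) (simp add: g idem m_assoc)
  have "t \<otimes> (t \<otimes> t) = e \<otimes> (t \<otimes> t) \<ominus> g \<otimes> (t \<otimes> t)"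
    by (simp add: t_def[unfolded minus_eq] minus_eq l_distr l_minus)
  also have "e \<otimes> (t \<otimes> t) = e \<ominus> h"
    unfolding \<open>t \<otimes> t = _\<close> by (simp add: minus_eq r_distr r_minus minus_add idem h flip: h_def) (simp add: a_ac r_neg r_neg1 r_neg2)
  also have "g \<otimes> (t \<otimes> t) = g \<ominus> h"
    unfolding \<open>t \<otimes> t = _\<close> by (simp add: minus_eq r_distr r_minus minus_add g h flip: h_def) (simp add: a_ac r_neg r_neg1 r_neg2)
  also have "(e \<ominus> h) \<ominus> (g \<ominus> h) = t"
    by (simp add: t_def minus_eq minus_add a_assoc a_comm[of "\<ominus> g" h] r_neg1)
  finally have ttt: "t \<otimes> (t \<otimes> t) = t" .
  have tw: "w \<otimes> t = t \<otimes> w"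
    by (simp add: t_def minus_eq l_distr r_distr l_minus r_minus com g)
  have tw': "w \<otimes> (t \<otimes> z) = t \<otimes> (w \<otimes> z)" if "z \<in> carrier R" for z
    using that by (simp add: tw flip: m_assoc)
  define q where "q = t \<otimes> t \<oplus> t \<otimes> t \<oplus> t \<otimes> t \<oplus> t \<otimes> w \<oplus> t \<otimes> w \<oplus> t \<otimes> w \<oplus> w \<otimes> w \<ominus> \<one>"
  have [simp]: "q \<in> carrier R" by (simp add: q_def)
  have "a \<otimes> a \<otimes> a \<ominus> a = w \<otimes> q"
    by (simp add: q_def a minus_eq l_distr r_distr l_minus r_minus m_assoc tw tw' minus_add a_ac ttt r_neg r_neg1 r_neg2)
  moreover have "w \<otimes> q = q \<otimes> w"
    by (simp add: q_def minus_eq l_distr r_distr l_minus r_minus m_assoc tw tw')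
  ultimately show ?thesis
    using nilpotent_mult_commuting[OF w] by simp
qed

end

context ring
begin

text \<open>
  For the rings below this is the Jacobson radical.  It is defined through nil right ideals, so that
  the absence of matrix units applies directly.
\<close>
definition nil_radical :: "'a set" where
  "nil_radical = {x \<in> carrier R. \<forall>r\<in>carrier R. ring_nilpotent R (x \<otimes> r)}"

lemma nil_radicalD:
  assumes "x \<in> nil_radical"
  shows "x \<in> carrier R" "r \<in> carrier R \<Longrightarrow> ring_nilpotent R (x \<otimes> r)" "ring_nilpotent R x"
  using assms r_one[of x] unfolding nil_radical_def by (auto dest!: bspec[of _ _ \<one>])

text \<open>
  That a sum of two nil right ideals is nil is an open problem for general rings.  Here it holds since
  nilpotency can be detected by invertibility: for $a = (x + y) r$ the element $1 - a^2$ is a product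
  of two units, so that $a$ is the product of the nilpotent element $a^3 - a$ and a unit commuting with
  it.
\<close>
lemma nil_radical_add:
  assumes cube: "\<And>a. a \<in> carrier R \<Longrightarrow> ring_nilpotent R (a \<otimes> a \<otimes> a \<ominus> a)"
    and x: "x \<in> nil_radical" and y: "y \<in> nil_radical"
  shows "x \<oplus> y \<in> nil_radical"
  unfolding nil_radical_def
proof (intro CollectI conjI ballI)
  note [simp] = nil_radicalD(1)[OF x] nil_radicalD(1)[OF y]
  show "x \<oplus> y \<in> carrier R" by simp
  fix r assume [simp]: "r \<in> carrier R"
  define a where "a = (x \<oplus> y) \<otimes> r"
  define s where "s = r \<otimes> a"
  have [simp]: "a \<in> carrier R" "s \<in> carrier R" by (simp_all add: a_def s_def)
  obtain v where [simp]: "v \<in> carrier R"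
    and v: "(\<one> \<ominus> x \<otimes> s) \<otimes> v = \<one>" "v \<otimes> (\<one> \<ominus> x \<otimes> s) = \<one>"
    using minus_one_nilpotent_inverse[OF nil_radicalD(2)[OF x, of s]] by auto
  define n where "n = v \<otimes> (y \<otimes> s)"
  have [simp]: "n \<in> carrier R" by (simp add: n_def)
  have "ring_nilpotent R (y \<otimes> (s \<otimes> v))"
    using nil_radicalD(2)[OF y] by simp
  then have "ring_nilpotent R n"
    using nilpotent_mult_swap[of "y \<otimes> s" v] by (simp add: n_def m_assoc)
  then obtain v' where [simp]: "v' \<in> carrier R"
    and v': "(\<one> \<ominus> n) \<otimes> v' = \<one>" "v' \<otimes> (\<one> \<ominus> n) = \<one>"
    using minus_one_nilpotent_inverse[of n] by auto
  define p where "p = \<one> \<ominus> x \<otimes> s"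
  define q where "q = \<one> \<ominus> n"
  define i where "i = v' \<otimes> v"
  have [simp]: "i \<in> carrier R" "p \<in> carrier R" "q \<in> carrier R" by (simp_all add: i_def p_def q_def)
  \<comment> \<open>$1 - (x + y) s = (1 - x s) (1 - v y s)$, where $v$ is the inverse of $1 - x s$.\<close>
  have "p \<otimes> q = p \<ominus> (p \<otimes> v) \<otimes> (y \<otimes> s)"
    by (simp add: q_def n_def minus_eq r_distr r_minus m_assoc)
  also have "\<dots> = \<one> \<ominus> a \<otimes> a"
    using v(1) by (simp add: p_def s_def minus_eq a_assoc flip: minus_add l_distr)
                  (simp add: a_def m_assoc)
  finally have pq: "p \<otimes> q = \<one> \<ominus> a \<otimes> a" .
  have "(p \<otimes> q) \<otimes> i = p \<otimes> ((q \<otimes> v') \<otimes> v)" by (simp add: i_def m_assoc)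
  then have i1: "(\<one> \<ominus> a \<otimes> a) \<otimes> i = \<one>"
    using v(1) v'(1) unfolding pq p_def[symmetric] q_def[symmetric] by simp
  have "i \<otimes> (p \<otimes> q) = v' \<otimes> ((v \<otimes> p) \<otimes> q)" by (simp add: i_def m_assoc)
  then have i2: "i \<otimes> (\<one> \<ominus> a \<otimes> a) = \<one>"
    using v(2) v'(2) unfolding pq p_def[symmetric] q_def[symmetric] by simp
  define u where "u = \<one> \<ominus> a \<otimes> a"
  have [simp]: "u \<in> carrier R" by (simp add: u_def)
  have ua: "u \<otimes> a = a \<otimes> u"
    by (simp add: u_def minus_eq l_distr r_distr l_minus r_minus m_assoc)
  have "i \<otimes> a = i \<otimes> (a \<otimes> u) \<otimes> i"
    using i1 by (simp add: m_assoc flip: u_def)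
  also have "\<dots> = (i \<otimes> u) \<otimes> (a \<otimes> i)" by (simp add: m_assoc flip: ua)
  finally have ia: "i \<otimes> a = a \<otimes> i" using i2 by (simp add: u_def)
  define m where "m = a \<otimes> a \<otimes> a \<ominus> a"
  have [simp]: "m \<in> carrier R" by (simp add: m_def)
  have m: "m = \<ominus> (a \<otimes> u)"
    by (simp add: m_def u_def minus_eq r_distr r_minus minus_add m_assoc a_comm)
  have "m \<otimes> (\<ominus> i) = a \<otimes> (u \<otimes> i)"
    by (simp add: m l_minus r_minus m_assoc)
  then have "m \<otimes> (\<ominus> i) = a" using i1 by (simp add: u_def)
  moreover have "m \<otimes> (\<ominus> i) = (\<ominus> i) \<otimes> m"
  proof -
    have "i \<otimes> (a \<otimes> u) = a \<otimes> (i \<otimes> u)" by (simp add: ia flip: m_assoc)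
    moreover have "i \<otimes> u = u \<otimes> i" using i1 i2 by (simp add: u_def)
    ultimately show ?thesis by (simp add: m l_minus r_minus m_assoc)
  qed
  ultimately show "ring_nilpotent R ((x \<oplus> y) \<otimes> r)"
    using nilpotent_mult_commuting[of m "\<ominus> i"] cube[of a] by (simp add: a_def[symmetric] m_def)
qed

lemma nil_radical_ideal:
  assumes cube: "\<And>a. a \<in> carrier R \<Longrightarrow> ring_nilpotent R (a \<otimes> a \<otimes> a \<ominus> a)"
  shows "ideal nil_radical R"
proof (rule idealI[OF ring_axioms])
  show "subgroup nil_radical (add_monoid R)"
  proof (rule add.subgroupI)
    show "nil_radical \<noteq> {}"
      by (auto simp: nil_radical_def intro!: exI[of _ \<zero>] nilpotentI[of _ 1])
    show "\<ominus> a \<in> nil_radical" if "a \<in> nil_radical" for a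
      using that nil_radicalD(2)[OF that]
      by (auto simp: nil_radical_def l_minus simp flip: r_minus)
  qed (use nil_radical_add[OF cube] in \<open>auto simp: nil_radical_def\<close>)
next
  fix a x assume a: "a \<in> nil_radical" and [simp]: "x \<in> carrier R"
  note [simp] = nil_radicalD(1)[OF a]
  show "a \<otimes> x \<in> nil_radical"
    using nil_radicalD(2)[OF a] by (auto simp: nil_radical_def m_assoc)
  show "x \<otimes> a \<in> nil_radical"
    using nilpotent_mult_swap[of "a \<otimes> _" x] nil_radicalD(2)[OF a]
    by (auto simp: nil_radical_def m_assoc)
qed

end

lemma (in ideal) quotient_zero_iff:
  assumes "x \<in> carrier R"
  shows "I +> x = \<zero>\<^bsub>R Quot I\<^esub> \<longleftrightarrow> x \<in> I"
  using assms rcos_const_imp_mem[of x] a_rcos_zero[OF ideal_axioms, of x]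
  by (auto simp: FactRing_def)

lemma (in ideal) quotient_carrierE:
  assumes "c \<in> carrier (R Quot I)"
  obtains x where "x \<in> carrier R" "c = I +> x"
  using assms by (auto simp: FactRing_def A_RCOSETS_def')

context ring_hom_ring
begin

lemma nilpotent_hom:
  assumes "ring_nilpotent R x" shows "ring_nilpotent S (h x)"
  using assms hom_nat_pow[of x] by (auto simp: ring_nilpotent_def) (metis hom_zero)

lemma hom_minus:
  assumes "x \<in> carrier R" "y \<in> carrier R" shows "h (x \<ominus> y) = h x \<ominus>\<^bsub>S\<^esub> h y"
  using assms by (simp add: R.minus_eq S.minus_eq)

lemma cube_hom:
  assumes "\<And>a. a \<in> carrier R \<Longrightarrow> ring_nilpotent R (a \<otimes> a \<otimes> a \<ominus> a)"
    and "a \<in> carrier R"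
  shows "ring_nilpotent S (h a \<otimes>\<^bsub>S\<^esub> h a \<otimes>\<^bsub>S\<^esub> h a \<ominus>\<^bsub>S\<^esub> h a)"
  using nilpotent_hom[OF assms(1)[OF assms(2)]] assms(2) by (simp add: hom_minus)

end

context ring
begin

text \<open>
  The condition on cubes passes to the quotient by the radical, where an element of square zero has
  only nilpotent right multiples.  Hence the radical contains every $z$ with $z^2$ in it, and by
  repeated squaring every nilpotent element.
\<close>
lemma nil_radical_eq_nilpotents:
  assumes cube: "\<And>a. a \<in> carrier R \<Longrightarrow> ring_nilpotent R (a \<otimes> a \<otimes> a \<ominus> a)"
  shows "x \<in> nil_radical \<longleftrightarrow> ring_nilpotent R x"
proof
  assume "ring_nilpotent R x"
  then obtain k :: nat where [simp]: "x \<in> carrier R" and k: "x [^] k = \<zero>"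
    by (rule nilpotentE)
  interpret J: ideal nil_radical R by (rule nil_radical_ideal[OF cube])
  let ?S = "R Quot nil_radical" and ?h = "(+>) nil_radical"
  interpret h: ring_hom_ring R ?S ?h by (rule J.rcos_ring_hom_ring)
  have cubeS: "ring_nilpotent ?S (c \<otimes>\<^bsub>?S\<^esub> c \<otimes>\<^bsub>?S\<^esub> c \<ominus>\<^bsub>?S\<^esub> c)" if "c \<in> carrier ?S" for c
    using that h.cube_hom[OF cube] by (elim J.quotient_carrierE) simp
  have square: "z \<in> nil_radical" if zz: "z \<otimes> z \<in> nil_radical" and [simp]: "z \<in> carrier R" for z
    unfolding nil_radical_def
  proof (intro CollectI conjI ballI)
    fix r assume [simp]: "r \<in> carrier R"
    have "?h z \<otimes>\<^bsub>?S\<^esub> ?h z = \<zero>\<^bsub>?S\<^esub>"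
      using zz J.quotient_zero_iff[of "z \<otimes> z"] by simp
    then have "ring_nilpotent ?S (?h z \<otimes>\<^bsub>?S\<^esub> ?h r)"
      by (intro h.S.square_zero_mult_nilpotent cubeS) auto
    then obtain j :: nat where "(?h z \<otimes>\<^bsub>?S\<^esub> ?h r) [^]\<^bsub>?S\<^esub> j = \<zero>\<^bsub>?S\<^esub>"
      by (rule h.S.nilpotentE)
    then have "?h ((z \<otimes> r) [^] j) = \<zero>\<^bsub>?S\<^esub>" by (simp add: h.hom_nat_pow)
    then have "(z \<otimes> r) [^] j \<in> nil_radical" using J.quotient_zero_iff by simp
    then show "ring_nilpotent R (z \<otimes> r)"
      using nil_radicalD(3) nilpotent_of_power[of "z \<otimes> r" j] by simp
  qed simp
  have "x [^] (2 ^ i :: nat) \<in> nil_radical \<Longrightarrow> x \<in> nil_radical" for i :: nat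
  proof (induction i)
    case (Suc i)
    have "x [^] (2 ^ i :: nat) \<otimes> x [^] (2 ^ i :: nat) \<in> nil_radical"
      using Suc.prems by (simp add: nat_pow_mult mult_2)
    then show ?case by (rule Suc.IH[OF square]) simp
  qed simp
  moreover have "x [^] (2 ^ k :: nat) = x [^] k \<otimes> x [^] (2 ^ k - k :: nat)"
    using less_exp[of k] by (simp add: nat_pow_mult)
  ultimately show "x \<in> nil_radical" using k J.zero_closed by (metis l_null nat_pow_closed \<open>x \<in> carrier R\<close>)
qed (rule nil_radicalD)

end

section \<open>Nil ideals of bounded index\<close>

context ring
begin

text \<open>
  Induction on $n$; let $n \<ge> 2$.  For $a, y, z \<in> P$ put $u = a^{n-1}$ and $b = u y$.  Then $a b = 0$, so
  only the monomials $b^i a^{n-i}$ survive in $(a + b)^n$, and $b^{n-2} (a + b)^n z = 0$ collapses to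
  $b^{n-1} a^{n-1} z = 0$.  This says that the right ideal $u P$ satisfies the hypothesis with $n - 1$
  in place of $n$, hence vanishes.  As $a$ was arbitrary, $P$ itself satisfies the hypothesis with
  $n - 1$.  Multiplying by an element of $P$, instead of requiring $y^n = 0$, is what makes this second
  use of the induction hypothesis possible.
\<close>
lemma prime_nil_right_ideal_zero:
  assumes prime: "\<And>a b. a \<in> carrier R \<Longrightarrow> b \<in> carrier R \<Longrightarrow>
      (\<And>r. r \<in> carrier R \<Longrightarrow> a \<otimes> (r \<otimes> b) = \<zero>) \<Longrightarrow> a = \<zero> \<or> b = \<zero>"
    and "P \<subseteq> carrier R"
    and "\<And>x y. x \<in> P \<Longrightarrow> y \<in> P \<Longrightarrow> x \<oplus> y \<in> P"
    and "\<And>x r. x \<in> P \<Longrightarrow> r \<in> carrier R \<Longrightarrow> x \<otimes> r \<in> P"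
    and "\<And>y z. y \<in> P \<Longrightarrow> z \<in> P \<Longrightarrow> y [^] (n::nat) \<otimes> z = \<zero>"
    and "x \<in> P"
  shows "x = \<zero>"
  using assms(2-)
proof (induction n arbitrary: P x)
  case 0
  then show ?case by (metis l_one nat_pow_0 subsetD)
next
  case (Suc m)
  note add = Suc.prems(2) and rmult = Suc.prems(3) and pow = Suc.prems(4)
  have car: "z \<in> carrier R" if "z \<in> P" for z using Suc.prems(1) that by auto
  show ?case
  proof (cases "m = 0")
    case True
    have "x \<otimes> (r \<otimes> x) = \<zero>" if "r \<in> carrier R" for r
      using pow[of "x \<otimes> r" x] rmult[of x r] that Suc.prems(5) car[of x] True by (simp add: m_assoc)
    then show ?thesis using prime[of x x] car Suc.prems(5) by auto
  next
    case False
    then obtain l where m: "m = Suc l" by (cases m) auto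
    have "a [^] m \<otimes> y = \<zero>" if a: "a \<in> P" and y: "y \<in> P" for a y
    proof -
      note [simp] = car[OF a] car[OF y]
      define u where "u = a [^] m"
      have [simp]: "u \<in> carrier R" by (simp add: u_def)
      have uP: "u \<otimes> z \<in> P" if "z \<in> P" for z
        using rmult[OF a, of "a [^] l \<otimes> z"] car[OF that]
        unfolding u_def m nat_pow_Suc2[OF car[OF a]] by (simp add: m_assoc del: nat_pow_Suc)
      have "(u \<otimes> y1) [^] m \<otimes> (u \<otimes> z) = \<zero>" if y1: "y1 \<in> P" and z: "z \<in> P" for y1 z
      proof -
        define b where "b = u \<otimes> y1"
        have b: "b \<in> P" unfolding b_def by (rule uP[OF y1])
        note [simp] = car[OF y1] car[OF z] car[OF b]
        have ab: "a \<otimes> b = \<zero>"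
          using pow[OF a y1] unfolding b_def u_def nat_pow_Suc2[OF car[OF a]]
          by (simp add: m_assoc)
        have akb: "a [^] Suc k \<otimes> (b \<otimes> w) = \<zero>" if "w \<in> carrier R" for w and k :: nat
        proof -
          have "a [^] Suc k \<otimes> (b \<otimes> w) = a [^] k \<otimes> ((a \<otimes> b) \<otimes> w)"
            using that by (simp add: m_assoc)
          then show ?thesis using that by (simp add: ab)
        qed
        have exp: "b [^] l \<otimes> ((a \<oplus> b) [^] Suc k \<otimes> w) = b [^] l \<otimes> (a [^] Suc k \<otimes> w) \<oplus> b [^] m \<otimes> (a [^] k \<otimes> w)"
          if "w \<in> P" for k :: nat and w
          using that
        proof (induction k arbitrary: w)
          case 0
          then show ?case using car[of w] by (simp add: m m_assoc l_distr r_distr)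
        next
          case (Suc k)
          note [simp] = car[OF Suc.prems]
          have w': "a \<otimes> w \<oplus> b \<otimes> w \<in> P"
            by (intro add rmult a b) simp_all
          have bkb: "b [^] m \<otimes> (a [^] k \<otimes> (b \<otimes> w)) = \<zero>"
          proof (cases k)
            case 0
            then show ?thesis using pow[OF b Suc.prems] by (simp add: m_assoc)
          next
            case (Suc k')
            then show ?thesis using akb[of w k'] by (simp del: nat_pow_Suc)
          qed
          have "b [^] l \<otimes> ((a \<oplus> b) [^] Suc (Suc k) \<otimes> w)
              = b [^] l \<otimes> ((a \<oplus> b) [^] Suc k \<otimes> (a \<otimes> w \<oplus> b \<otimes> w))"
            unfolding nat_pow_Suc[of _ "Suc k"] by (simp add: m_assoc l_distr del: nat_pow_Suc)
          also have "\<dots> = b [^] l \<otimes> (a [^] Suc k \<otimes> (a \<otimes> w)) \<oplus> b [^] m \<otimes> (a [^] k \<otimes> (a \<otimes> w))"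
            unfolding Suc.IH[OF w'] using akb[of w k] bkb by (simp add: r_distr del: nat_pow_Suc)
          finally show ?case by (simp add: m_assoc)
        qed
        have "b [^] l \<otimes> ((a \<oplus> b) [^] Suc m \<otimes> z) = \<zero>"
          using pow[OF add[OF a b] z] by simp
        then have "b [^] m \<otimes> (a [^] m \<otimes> z) = \<zero>"
          unfolding exp[OF z] pow[OF a z] by simp
        then show ?thesis by (simp add: b_def u_def)
      qed
      note vanish = this
      have "u \<otimes> y = \<zero>"
      proof (rule Suc.IH[of "(\<lambda>z. u \<otimes> z) ` P"])
        show "(\<lambda>z. u \<otimes> z) ` P \<subseteq> carrier R" using car by auto
        show "u \<otimes> y \<in> (\<lambda>z. u \<otimes> z) ` P" using y by simp
      next
        fix c d assume "c \<in> (\<lambda>z. u \<otimes> z) ` P" "d \<in> (\<lambda>z. u \<otimes> z) ` P"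
        then obtain p q where pq: "p \<in> P" "q \<in> P" "c = u \<otimes> p" "d = u \<otimes> q" by blast
        then have "c \<oplus> d = u \<otimes> (p \<oplus> q)" by (simp add: r_distr car)
        then show "c \<oplus> d \<in> (\<lambda>z. u \<otimes> z) ` P" using add[OF pq(1,2)] by blast
        show "c [^] m \<otimes> d = \<zero>" using vanish pq by simp
      next
        fix c r assume "c \<in> (\<lambda>z. u \<otimes> z) ` P" and r: "r \<in> carrier R"
        then obtain p where p: "p \<in> P" "c = u \<otimes> p" by blast
        then have "c \<otimes> r = u \<otimes> (p \<otimes> r)" using r by (simp add: m_assoc car)
        then show "c \<otimes> r \<in> (\<lambda>z. u \<otimes> z) ` P" using rmult[OF p(1) r] by blast
      qed
      then show ?thesis by (simp add: u_def)
    qed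
    from Suc.IH[OF Suc.prems(1) add rmult this Suc.prems(5)] show ?thesis .
  qed
qed

primrec words :: "'a set \<Rightarrow> nat \<Rightarrow> 'a set" where
  "words X 0 = {\<one>}"
| "words X (Suc m) = (\<lambda>(x, w). x \<otimes> w) ` (X \<times> words X m)"

lemma finite_words: "finite X \<Longrightarrow> finite (words X m)"
  by (induction m) auto

lemma words_closed: "X \<subseteq> carrier R \<Longrightarrow> words X m \<subseteq> carrier R"
  by (induction m) auto

lemma words_add:
  assumes "X \<subseteq> carrier R" "w \<in> words X (l + m)"
  shows "\<exists>u\<in>words X l. \<exists>v\<in>words X m. w = u \<otimes> v"
  using assms(2)
proof (induction l arbitrary: w)
  case 0
  then show ?case using words_closed[OF assms(1), of m] by (auto intro!: bexI[of _ w])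
next
  case (Suc l)
  then obtain x w' where "x \<in> X" "w' \<in> words X (l + m)" "w = x \<otimes> w'" by auto
  moreover obtain u v where "u \<in> words X l" "v \<in> words X m" "w' = u \<otimes> v"
    using Suc.IH[OF \<open>w' \<in> _\<close>] by auto
  moreover have "x \<in> carrier R" "u \<in> carrier R" "v \<in> carrier R"
    using calculation assms(1) words_closed[OF assms(1)] by blast+
  ultimately show ?case by (fastforce simp: m_assoc[symmetric])
qed

text \<open>
  Levitzki's theorem for nil ideals of bounded index.  If no power of $X$ vanished, there would be, by
  Zorn's lemma, an ideal $I$ maximal among those that contain no power of $X$; since $X$ is finite, this
  property survives unions of chains.  Two ideals properly containing $I$ contain powers of $X$, hence
  so does their product; therefore $I$ is prime.  In the prime ring $R / I$ the image of $J$ is a nil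
  right ideal of bounded index, so it is zero and $X \<subseteq> J \<subseteq> I$, a contradiction.
\<close>
lemma nil_bounded_index_locally_nilpotent:
  assumes J: "ideal J R" and pow: "\<And>x. x \<in> J \<Longrightarrow> x [^] (k::nat) = \<zero>"
    and X: "finite X" "X \<subseteq> J"
  shows "\<exists>m. words X m \<subseteq> {\<zero>}"
proof (rule ccontr)
  assume no: "\<nexists>m. words X m \<subseteq> {\<zero>}"
  interpret J: ideal J R by fact
  have XR: "X \<subseteq> carrier R" using X J.a_subset by auto
  note wR = words_closed[OF XR]
  define F where "F = {I. ideal I R \<and> (\<forall>m. \<not> words X m \<subseteq> I)}"
  have "\<exists>I\<in>F. \<forall>I'\<in>F. I \<subseteq> I' \<longrightarrow> I' = I"
  proof (rule subset_Zorn_nonempty)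
    show "F \<noteq> {}" using no zeroideal by (auto simp: F_def)
    fix C assume C: "C \<noteq> {}" "subset.chain F C"
    have "ideal (\<Union>C) R"
      using chain_Union_is_ideal[of C] C by (auto simp: F_def subset.chain_def)
    moreover have False if m: "words X m \<subseteq> \<Union>C" for m
    proof -
      obtain I where "I \<in> C" "words X m \<subseteq> I"
        using finite_subset_Union_chain[OF finite_words[OF X(1)] m C] by metis
      then show False using C by (auto simp: F_def subset.chain_def)
    qed
    ultimately show "\<Union>C \<in> F" by (auto simp: F_def)
  qed
  then obtain I where "I \<in> F" and max: "\<And>I'. I' \<in> F \<Longrightarrow> I \<subseteq> I' \<Longrightarrow> I' = I" by blast
  then have I: "ideal I R" and notI: "\<And>m. \<not> words X m \<subseteq> I" by (auto simp: F_def)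
  interpret I: ideal I R by fact
  have big: "\<exists>m. words X m \<subseteq> A" if "ideal A R" "I \<subseteq> A" "a \<in> A" "a \<notin> I" for A a
    using max[of A] that by (auto simp: F_def)
  have prime: "a \<in> I \<or> b \<in> I"
    if [simp]: "a \<in> carrier R" "b \<in> carrier R" and ab: "\<And>r. r \<in> carrier R \<Longrightarrow> a \<otimes> (r \<otimes> b) \<in> I" for a b
  proof (rule ccontr)
    assume neg: "\<not> (a \<in> I \<or> b \<in> I)"
    \<comment> \<open>These ideals take the role of the ideals generated by $I$ and $a$, respectively $I$ and $b$.\<close>
    define A where "A = {y \<in> carrier R. \<forall>r\<in>carrier R. y \<otimes> (r \<otimes> b) \<in> I}"
    define B where "B = {z \<in> carrier R. \<forall>y\<in>A. \<forall>r\<in>carrier R. y \<otimes> (r \<otimes> z) \<in> I}"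
    have AR: "\<And>y. y \<in> A \<Longrightarrow> y \<in> carrier R" by (simp add: A_def)
    have "ideal A R"
    proof (rule idealI[OF ring_axioms])
      show "subgroup A (add_monoid R)"
      proof (rule add.subgroupI)
        show "A \<noteq> {}" using ab by (auto simp: A_def)
      qed (auto simp: A_def l_distr l_minus)
      fix y x assume y: "y \<in> A" and [simp]: "x \<in> carrier R"
      have [simp]: "y \<in> carrier R" and yI: "\<And>r. r \<in> carrier R \<Longrightarrow> y \<otimes> (r \<otimes> b) \<in> I"
        using y by (simp_all add: A_def)
      show "x \<otimes> y \<in> A"
        using I.I_l_closed[OF yI \<open>x \<in> _\<close>] by (simp add: A_def m_assoc)
      have "y \<otimes> (x \<otimes> (r \<otimes> b)) \<in> I" if "r \<in> carrier R" for r
        using yI[of "x \<otimes> r"] that by (simp add: m_assoc)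
      then show "y \<otimes> x \<in> A" by (simp add: A_def m_assoc)
    qed
    moreover have "I \<subseteq> A" using I.I_r_closed by (auto simp: A_def)
    moreover have "a \<in> A" using ab by (simp add: A_def)
    ultimately obtain m where m: "words X m \<subseteq> A" using big neg by blast
    have "ideal B R"
    proof (rule idealI[OF ring_axioms])
      show "subgroup B (add_monoid R)"
      proof (rule add.subgroupI)
        show "B \<noteq> {}" by (auto simp: B_def A_def)
      qed (auto simp: B_def AR r_distr r_minus)
      fix y x assume y: "y \<in> B" and [simp]: "x \<in> carrier R"
      have [simp]: "y \<in> carrier R"
        and yI: "\<And>z r. z \<in> A \<Longrightarrow> r \<in> carrier R \<Longrightarrow> z \<otimes> (r \<otimes> y) \<in> I"
        using y by (simp_all add: B_def)
      show "y \<otimes> x \<in> B"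
        using I.I_r_closed[OF yI \<open>x \<in> _\<close>] by (simp add: B_def AR m_assoc)
      have "z \<otimes> (r \<otimes> (x \<otimes> y)) \<in> I" if "z \<in> A" "r \<in> carrier R" for z r
        using yI[of z "r \<otimes> x"] that by (simp add: m_assoc AR)
      then show "x \<otimes> y \<in> B" by (simp add: B_def)
    qed
    moreover have "I \<subseteq> B" using I.I_l_closed AR by (auto simp: B_def)
    moreover have "b \<in> B" by (simp add: B_def A_def)
    ultimately obtain l where l: "words X l \<subseteq> B" using big neg by blast
    have "words X (m + l) \<subseteq> I"
    proof
      fix w assume "w \<in> words X (m + l)"
      then obtain u v where "u \<in> words X m" "v \<in> words X l" "w = u \<otimes> v"
        using words_add[OF XR] by blast
      then have "v \<in> carrier R" "u \<in> A" "\<forall>y\<in>A. \<forall>r\<in>carrier R. y \<otimes> (r \<otimes> v) \<in> I"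
        using m l by (auto simp: B_def)
      then have "v \<in> carrier R" "u \<in> A" "\<forall>y\<in>A. \<forall>r\<in>carrier R. y \<otimes> (r \<otimes> v) \<in> I"
        using m l by (auto simp: B_def)
      then have "v \<in> carrier R" "u \<otimes> (\<one> \<otimes> v) \<in> I"
        using one_closed by blast+
      then show "w \<in> I" using \<open>w = _\<close> by simp
    qed
    with notI show False by blast
  qed
  let ?S = "R Quot I" and ?h = "(+>) I"
  interpret h: ring_hom_ring R ?S ?h by (rule I.rcos_ring_hom_ring)
  have "?h x = \<zero>\<^bsub>?S\<^esub>" if x: "x \<in> J" for x
  proof (rule h.S.prime_nil_right_ideal_zero[where P = "?h ` J" and n = k])
    fix c d assume cd: "c \<in> carrier ?S" "d \<in> carrier ?S"
      "\<And>r. r \<in> carrier ?S \<Longrightarrow> c \<otimes>\<^bsub>?S\<^esub> (r \<otimes>\<^bsub>?S\<^esub> d) = \<zero>\<^bsub>?S\<^esub>"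
    obtain a b where [simp]: "a \<in> carrier R" "b \<in> carrier R" and ab: "c = ?h a" "d = ?h b"
      using cd by (metis I.quotient_carrierE)
    have "a \<otimes> (r \<otimes> b) \<in> I" if [simp]: "r \<in> carrier R" for r
      using cd(3)[of "?h r"] I.quotient_zero_iff[of "a \<otimes> (r \<otimes> b)"] by (simp add: ab)
    then have "a \<in> I \<or> b \<in> I" by (intro prime) auto
    then show "c = \<zero>\<^bsub>?S\<^esub> \<or> d = \<zero>\<^bsub>?S\<^esub>" by (simp add: ab I.quotient_zero_iff)
  next
    show "?h ` J \<subseteq> carrier ?S" using J.a_subset by auto
  next
    fix c d assume "c \<in> ?h ` J" "d \<in> ?h ` J"
    then obtain a b where "a \<in> J" "b \<in> J" "c = ?h a" "d = ?h b" by blast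
    then show "c \<oplus>\<^bsub>?S\<^esub> d \<in> ?h ` J" "c [^]\<^bsub>?S\<^esub> k \<otimes>\<^bsub>?S\<^esub> d = \<zero>\<^bsub>?S\<^esub>"
      using pow[of a] by (auto simp flip: h.hom_add h.hom_nat_pow)
  next
    fix c r assume "c \<in> ?h ` J" "r \<in> carrier ?S"
    then obtain a s where "a \<in> J" "s \<in> carrier R" "c = ?h a" "r = ?h s"
      by (metis I.quotient_carrierE imageE)
    then show "c \<otimes>\<^bsub>?S\<^esub> r \<in> ?h ` J"
      using J.I_r_closed by (auto simp flip: h.hom_mult)
  qed (use x in auto)
  then have "J \<subseteq> I" using I.quotient_zero_iff by auto
  then have "words X 1 \<subseteq> I" using X J.a_subset by auto
  with notI show False by blast
qed

end

section \<open>Matrices over a nil ideal of bounded index\<close>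

lemma matrix_ring_mem:
  "A \<in> carrier (matrix_ring R n) \<longleftrightarrow> A \<in> carrier_mat n n \<and> (\<forall>i<n. \<forall>j<n. A $$ (i, j) \<in> carrier R)"
  by (simp add: matrix_ring_def)

lemma matrix_ring_index:
  assumes "i < n" "j < n"
  shows "(A \<oplus>\<^bsub>matrix_ring R n\<^esub> B) $$ (i, j) = A $$ (i, j) \<oplus>\<^bsub>R\<^esub> B $$ (i, j)"
    and "(A \<otimes>\<^bsub>matrix_ring R n\<^esub> B) $$ (i, j) = (\<Oplus>\<^bsub>R\<^esub>k\<in>{..<n}. A $$ (i, k) \<otimes>\<^bsub>R\<^esub> B $$ (k, j))"
    and "\<one>\<^bsub>matrix_ring R n\<^esub> $$ (i, j) = (if i = j then \<one>\<^bsub>R\<^esub> else \<zero>\<^bsub>R\<^esub>)"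
    and "\<zero>\<^bsub>matrix_ring R n\<^esub> $$ (i, j) = \<zero>\<^bsub>R\<^esub>"
  using assms by (simp_all add: matrix_ring_def)

lemma matrix_ring_eqI:
  assumes "A \<in> carrier (matrix_ring R n)" "B \<in> carrier (matrix_ring R n)"
    and "\<And>i j. i < n \<Longrightarrow> j < n \<Longrightarrow> A $$ (i, j) = B $$ (i, j)"
  shows "A = B"
  using assms by (intro eq_matI) (auto simp: matrix_ring_mem)

text \<open>
  The entries of $A^m$ are sums of products of $m$ entries of $A$, and all sufficiently long products of
  the finitely many entries vanish.
\<close>
lemma (in ring) nil_bounded_index_matrix_nilpotent:
  assumes J: "ideal J R" and pow: "\<And>x. x \<in> J \<Longrightarrow> x [^] (k::nat) = \<zero>"
    and A: "A \<in> carrier (matrix_ring R n)" "\<And>i j. i < n \<Longrightarrow> j < n \<Longrightarrow> A $$ (i, j) \<in> J"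
  shows "ring_nilpotent (matrix_ring R n) A"
proof -
  interpret M: ring "matrix_ring R n" by (rule ring_matrix_ring[OF ring_axioms])
  define X where "X = (\<lambda>(i, j). A $$ (i, j)) ` ({..<n} \<times> {..<n})"
  have "finite X" "X \<subseteq> J" using A(2) by (auto simp: X_def)
  then obtain N where N: "words X N \<subseteq> {\<zero>}"
    using nil_bounded_index_locally_nilpotent[OF J pow] by blast
  have entry: "B $$ (i, j) \<in> carrier R" if "B \<in> carrier (matrix_ring R n)" "i < n" "j < n" for B i j
    using that by (simp add: matrix_ring_mem)
  have XR: "X \<subseteq> carrier R" using entry[OF A(1)] by (auto simp: X_def)
  \<comment> \<open>Multiplying by a word $v$ of the complementary length avoids expanding $A^m$ into such sums.\<close>
  have "(A [^]\<^bsub>matrix_ring R n\<^esub> m) $$ (i, j) \<otimes> v = \<zero>"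
    if "v \<in> words X l" "l + m = N" "i < n" "j < n" for v l m i j
    using that
  proof (induction m arbitrary: l v i j)
    case 0
    then show ?case using N by (auto simp: matrix_ring_index)
  next
    case (Suc m)
    let ?B = "A [^]\<^bsub>matrix_ring R n\<^esub> m"
    have B: "?B \<in> carrier (matrix_ring R n)" using A(1) by simp
    have v: "v \<in> carrier R" using words_closed[OF XR] Suc.prems(1) by blast
    have "?B $$ (i, k) \<otimes> A $$ (k, j) \<otimes> v = \<zero>" if "k < n" for k
    proof -
      have "A $$ (k, j) \<in> X" using Suc.prems that by (auto simp: X_def)
      then have "A $$ (k, j) \<otimes> v \<in> words X (Suc l)"
        using Suc.prems(1) by (auto intro!: image_eqI[of _ _ "(A $$ (k, j), v)"])
      from Suc.IH[OF this _ Suc.prems(3) that] Suc.prems(2)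
      show ?thesis using entry[OF B Suc.prems(3) that] entry[OF A(1) that Suc.prems(4)] v
        by (simp add: m_assoc)
    qed
    then have "(\<Oplus>k\<in>{..<n}. ?B $$ (i, k) \<otimes> A $$ (k, j) \<otimes> v) = (\<Oplus>k\<in>{..<n}. \<zero>)"
      by (intro finsum_cong') auto
    then show ?case
      using entry[OF B] entry[OF A(1)] Suc.prems v by (simp add: matrix_ring_index finsum_ldistr Pi_def)
  qed
  from this[of \<one> 0 N] have "A [^]\<^bsub>matrix_ring R n\<^esub> N = \<zero>\<^bsub>matrix_ring R n\<^esub>"
    using A(1) entry[of "A [^]\<^bsub>matrix_ring R n\<^esub> N"]
    by (intro matrix_ring_eqI) (auto simp: matrix_ring_index)
  then show ?thesis using M.nilpotentI A(1) by blast
qed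

section \<open>Endomorphisms over the fields with two and three elements\<close>

text \<open>
  The condition on scalars describes the fields with two and with three elements at once.
\<close>
locale small_field_space = vector_space scale
  for scale :: "'k::field \<Rightarrow> 'v::ab_group_add \<Rightarrow> 'v" +
  assumes tri: "x = 0 \<or> x = 1 \<or> x = (- 1 :: 'k)"
begin

abbreviation lin :: "('v \<Rightarrow> 'v) \<Rightarrow> bool" where
  "lin f \<equiv> Vector_Spaces.linear scale scale f"

lemma linI:
  assumes "\<And>x y. f (x + y) = f x + f y" "\<And>c x. f (scale c x) = scale c (f x)"
  shows "lin f"
  using assms vector_space_axioms by (simp add: Vector_Spaces.linear_iff)

lemma linD:
  assumes "lin f"
  shows "f (x + y) = f x + f y" "f (scale c x) = scale c (f x)" "f 0 = 0"
    "f (- x) = - f x" "f (x - y) = f x - f y" "f (sum g S) = (\<Sum>a\<in>S. f (g a))"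
proof -
  interpret f: Vector_Spaces.linear scale scale f by fact
  show "f (x + y) = f x + f y" "f (scale c x) = scale c (f x)" "f 0 = 0"
    "f (- x) = - f x" "f (x - y) = f x - f y" "f (sum g S) = (\<Sum>a\<in>S. f (g a))"
    by (rule f.add f.scale f.zero f.neg f.diff f.sum)+
qed

lemma lin_pow: "lin f \<Longrightarrow> lin (f ^^ k)"
  by (induction k) (auto intro!: linI simp: linD)

lemma pow_zero_mono:
  assumes "lin f" "(f ^^ k) x = 0" "k \<le> l"
  shows "(f ^^ l) x = 0"
proof -
  have "(f ^^ l) x = (f ^^ (l - k)) ((f ^^ k) x)"
    using assms(3) funpow_add[of "l - k" k f] by simp
  then show ?thesis using linD(3)[OF lin_pow[OF assms(1)]] assms(2) by simp
qed

lemma chain_nilpotent: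
  assumes W: "lin W" and step: "\<And>i. i < r \<Longrightarrow> W (v i) = v (Suc i)"
    and last: "W (W (v r)) = 0" and "i \<le> r"
  shows "(W ^^ (r + 2)) (v i) = 0"
proof -
  from \<open>i \<le> r\<close> have "(W ^^ (r - i + 2)) (v i) = 0"
  proof (induction i rule: inc_induct)
    case base
    then show ?case using last by (simp add: numeral_2_eq_2)
  next
    case (step n)
    have "r - n + 2 = Suc (r - Suc n + 2)" using step.hyps by simp
    then show ?case using step assms(2)[of n] by (simp add: funpow_swap1 del: funpow.simps) (simp add: funpow_swap1)
  qed
  then show ?thesis by (rule pow_zero_mono[OF W]) simp
qed

text \<open>
  The heart of the matter.  In the basis $u_0, \<dots>, u_{m-1}$ the map $B$ is a companion matrix; its
  trace $t$ is the coefficient of $u_{m-1}$ in $B u_{m-1}$.  If $t = \<plusminus> 1$, the last column of the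
  companion matrix is $\<plusminus>$ an idempotent and the rest is a nilpotent shift.
  
  If $t = 0$ and $m \<ge> 3$, pass to the basis $v_0 = u_0$, $v_j = u_j - u_{j-1}$, in which $B$ maps $v_0$ to
  $v_0 + v_1$, maps $v_j$ to $v_{j+1}$ for $0 < j < m - 1$, and has the diagonal $1, 0, \<dots>, 0, -1$.
  Let $P$ map $v_0$ to $v_0 + v_1$ and kill the other basis vectors; let $Q$ map $v_{m-1}$ to the negative
  of $B v_{m-1}$ without its $v_0$-component and kill the others.  What remains is the nilpotent chain
  $v_1 \<mapsto> v_2 \<mapsto> \<dots> \<mapsto> v_{m-1}$, with $v_{m-1}$ going to a multiple of $v_0$ and $v_0$ to $0$.  In terms
  of the original basis, $P$ sends every $u_j$ to $u_1$.
  
  If $t = 0$ and $m = 2$, then $B^2$ is a scalar $c$ on the block, and each of the three values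
  of $c$ has its own decomposition.
\<close>
lemma cyclic_block_decomposition:
  assumes B: "lin B" and m: "0 < m"
    and indep: "independent (u ` {..<m})" "inj_on u {..<m}"
    and step: "\<And>j. Suc j < m \<Longrightarrow> B (u j) = u (Suc j)"
    and last: "B (u (m - 1)) = (\<Sum>j<m. scale (c j) (u j))"
  shows "\<exists>P Q W. lin P \<and> lin Q \<and> lin W \<and>
    (\<forall>j<m. P (u j) \<in> span (u ` {..<m}) \<and> Q (u j) \<in> span (u ` {..<m}) \<and> W (u j) \<in> span (u ` {..<m}) \<and>
      P (P (u j)) = P (u j) \<and> Q (Q (u j)) = Q (u j) \<and> P (Q (u j)) = 0 \<and> Q (P (u j)) = 0 \<and>
      B (u j) = P (u j) - Q (u j) + W (u j)) \<and>
    (\<exists>N. \<forall>j<m. (W ^^ N) (u j) = 0)"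
proof -
  let ?U = "span (u ` {..<m})"
  have ext: "\<exists>f. lin f \<and> (\<forall>j<m. f (u j) = g j)" for g
  proof -
    interpret p: vector_space_pair scale scale by unfold_locales
    obtain f where "lin f" "\<forall>x\<in>u ` {..<m}. f x = g (the_inv_into {..<m} u x)"
      using p.linear_independent_extend[OF indep(1), of "\<lambda>x. g (the_inv_into {..<m} u x)"] by blast
    then show ?thesis using the_inv_into_f_f[OF indep(2)] by auto
  qed
  have uU: "u j \<in> ?U" if "j < m" for j using that by (auto intro: span_base)
  define y where "y = (\<Sum>j<m. scale (c j) (u j))"
  have yU: "y \<in> ?U" unfolding y_def by (auto intro!: span_sum span_scale uU)
  have zero: "lin (\<lambda>_. 0)" by (rule linI) auto
  define t where "t = c (m - 1)"
  have split_last: "(\<Sum>j<m. f j) = (\<Sum>j<m - 1. f j) + f (m - 1)" for f :: "nat \<Rightarrow> 'v"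
    using sum.lessThan_Suc[of f "m - 1"] m by simp
  have concl: ?thesis
    if "lin P" "lin Q" "lin W"
      "\<And>j. j < m \<Longrightarrow> P (u j) \<in> ?U" "\<And>j. j < m \<Longrightarrow> Q (u j) \<in> ?U" "\<And>j. j < m \<Longrightarrow> W (u j) \<in> ?U"
      "\<And>j. j < m \<Longrightarrow> P (P (u j)) = P (u j)" "\<And>j. j < m \<Longrightarrow> Q (Q (u j)) = Q (u j)"
      "\<And>j. j < m \<Longrightarrow> P (Q (u j)) = 0" "\<And>j. j < m \<Longrightarrow> Q (P (u j)) = 0"
      "\<And>j. j < m \<Longrightarrow> B (u j) = P (u j) - Q (u j) + W (u j)"
      "\<And>j. j < m \<Longrightarrow> (W ^^ N) (u j) = 0" for P Q W N
  proof (rule exI[of _ P], rule exI[of _ Q], rule exI[of _ W], intro conjI allI impI)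
    show "\<exists>N. \<forall>j<m. (W ^^ N) (u j) = 0" using that(12) by blast
  qed (fact that | (rule that, assumption))+
  show ?thesis
  proof (cases "t = 0")
    case False
    then have t: "t = 1 \<or> t = - 1" using tri by blast
    obtain W where W: "lin W" "\<And>j. j < m \<Longrightarrow> W (u j) = (if j = m - 1 then 0 else u (Suc j))"
      using ext[of "\<lambda>j. if j = m - 1 then 0 else u (Suc j)"] by blast
    have nil: "(W ^^ (m - 1 + 2)) (u j) = 0" if "j < m" for j
      by (rule chain_nilpotent[OF W(1)]) (use that W linD(3)[OF W(1)] m in auto)
    \<comment> \<open>$E$ is $t$ times the last column, an idempotent map.\<close>
    obtain E where E: "lin E" "\<And>j. j < m \<Longrightarrow> E (u j) = (if j = m - 1 then scale t y else 0)"
      using ext[of "\<lambda>j. if j = m - 1 then scale t y else 0"] by blast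
    have "E y = scale t (E (u (m - 1)))"
      using E(2) by (simp add: y_def linD[OF E(1)] split_last t_def)
    then have Ey: "E y = y" using E(2) t m by (auto simp: scale_minus_left)
    have EE: "E (E (u j)) = E (u j)" if "j < m" for j
      using E(2)[OF that] linD[OF E(1)] Ey by (auto simp: linD[OF E(1)])
    have EU: "E (u j) \<in> ?U" "W (u j) \<in> ?U" if "j < m" for j
      using E(2)[OF that] W(2)[OF that] yU uU[of "Suc j"] that by (auto intro: span_scale span_zero)
    have Buj: "B (u j) = scale t (E (u j)) + W (u j)" if "j < m" for j
      using E(2)[OF that] W(2)[OF that] step[of j] last that t by (auto simp: y_def)
    show ?thesis
    proof (cases "t = 1")
      case True
      then show ?thesis
        using E(1) W(1) zero EE EU Buj nil linD(3)[OF E(1)] span_zero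
        by (intro concl[of E "\<lambda>_. 0" W "m - 1 + 2"]) auto
    next
      case False
      then have "t = - 1" using t by blast
      then show ?thesis
        using E(1) W(1) zero EE EU Buj nil linD(3)[OF E(1)] span_zero
        by (intro concl[of "\<lambda>_. 0" E W "m - 1 + 2"]) auto
    qed
  next
    case t0: True
    consider "m = 1" | "m = 2" | "3 \<le> m" using m by linarith
    then show ?thesis
    proof cases
      case 1
      then have "B (u 0) = 0" using last t0 by (simp add: t_def)
      then show ?thesis using zero 1 span_zero
        by (intro concl[of "\<lambda>_. 0" "\<lambda>_. 0" "\<lambda>_. 0" 1]) auto
    next
      case m2: 2
      then have Bu: "B (u 0) = u 1" "B (u 1) = scale (c 0) (u 0)"
        using step[of 0] last t0 by (auto simp: t_def numeral_2_eq_2)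
      have lt2: "(\<forall>j<m. A j) \<longleftrightarrow> A 0 \<and> A 1" for A :: "nat \<Rightarrow> bool"
        by (auto simp: m2 less_2_cases_iff)
      have j01: "j = 0 \<or> j = 1" if "j < m" for j using that m2 by auto
      have concl2: ?thesis
        if "lin P" "lin Q" "lin W"
          "P (u 0) \<in> ?U" "P (u 1) \<in> ?U" "Q (u 0) \<in> ?U" "Q (u 1) \<in> ?U" "W (u 0) \<in> ?U" "W (u 1) \<in> ?U"
          "P (P (u 0)) = P (u 0)" "P (P (u 1)) = P (u 1)" "Q (Q (u 0)) = Q (u 0)" "Q (Q (u 1)) = Q (u 1)"
          "P (Q (u 0)) = 0" "P (Q (u 1)) = 0" "Q (P (u 0)) = 0" "Q (P (u 1)) = 0"
          "B (u 0) = P (u 0) - Q (u 0) + W (u 0)" "B (u 1) = P (u 1) - Q (u 1) + W (u 1)"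
          "W (W (u 0)) = 0" "W (W (u 1)) = 0" for P Q W
        by (rule concl[of P Q W 2]) (use that in \<open>auto dest!: j01 simp: numeral_2_eq_2\<close>)
      have uU2: "u 0 \<in> ?U" "u (Suc 0) \<in> ?U" using uU[of 0] uU[of 1] m2 by auto
      obtain W where W: "lin W" "W (u 0) = u 1 - u 0" "W (u 1) = u 1 - u 0"
        using ext[of "\<lambda>j. u 1 - u 0"] unfolding lt2 by auto
      obtain e0 where e0: "lin e0" "e0 (u 0) = u 0" "e0 (u 1) = 0"
        using ext[of "\<lambda>j. if j = 0 then u 0 else 0"] unfolding lt2 by auto
      obtain e1 where e1: "lin e1" "e1 (u 0) = 0" "e1 (u 1) = u 1"
        using ext[of "\<lambda>j. if j = 0 then 0 else u 1"] unfolding lt2 by auto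
      obtain P where P: "lin P" "P (u 0) = u 0" "P (u 1) = u 0"
        using ext[of "\<lambda>j. u 0"] unfolding lt2 by auto
      obtain Q where Q: "lin Q" "Q (u 0) = 0" "Q (u 1) = u 1 - u 0"
        using ext[of "\<lambda>j. if j = 0 then 0 else u 1 - u 0"] unfolding lt2 by auto
      consider "c 0 = 0" | "c 0 = 1" | "c 0 = - 1" using tri by blast
      then show ?thesis
      proof cases
        case 1
        then show ?thesis using B Bu zero span_zero uU2
          by (intro concl2[of "\<lambda>_. 0" "\<lambda>_. 0" B]) (auto simp: linD[OF B])
      next
        case 2
        then show ?thesis using P Q W Bu uU2
          by (intro concl2[of P Q W])
             (auto intro!: span_diff span_zero simp: linD[OF P(1)] linD[OF Q(1)] linD[OF W(1)])
      next
        case 3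
        then show ?thesis using e0 e1 W Bu uU2
          by (intro concl2[of e0 e1 W])
             (auto intro!: span_diff span_zero simp: linD[OF e0(1)] linD[OF e1(1)] linD[OF W(1)])
      qed
    next
      case m3: 3
      \<comment> \<open>$z_0$ makes the coefficients of $z$ with respect to the $u_j$ sum to zero, that is $P z = 0$.\<close>
      define z0 where "z0 = (\<Sum>j=1..<m - 1. c j) - 1"
      define z where "z = u (m - 1) - (\<Sum>j=1..<m - 1. scale (c j) (u j)) + scale z0 (u 0)"
      define w where "w = u (m - 1) - u 1 + scale (c 0 + z0) (u 0)"
      have y: "y = scale (c 0) (u 0) + (\<Sum>j=1..<m - 1. scale (c j) (u j))"
      proof -
        have "y = (\<Sum>j=0..<m - 1. scale (c j) (u j))"
          using t0 by (simp add: y_def split_last t_def atLeast0LessThan)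
        then show ?thesis using m3 by (simp add: sum.atLeast_Suc_lessThan)
      qed
      obtain P where P: "lin P" "\<And>j. j < m \<Longrightarrow> P (u j) = u 1"
        using ext[of "\<lambda>j. u 1"] by blast
      obtain Q where Q: "lin Q" "\<And>j. j < m \<Longrightarrow> Q (u j) = (if j = m - 1 then z else 0)"
        using ext[of "\<lambda>j. if j = m - 1 then z else 0"] by blast
      define wf where "wf = (\<lambda>j. if j = 0 then 0 else if j = m - 1 then w else u (Suc j) - u 1)"
      obtain W where W: "lin W" "\<And>j. j < m \<Longrightarrow> W (u j) = wf j"
        using ext[of wf] by blast
      have zU: "z \<in> ?U" "w \<in> ?U" unfolding z_def w_def
        using m3 by (auto intro!: span_add span_diff span_scale span_sum uU)
      have Psum: "(\<Sum>j=1..<m - 1. scale (c j) (P (u j))) = scale (\<Sum>j=1..<m - 1. c j) (u 1)"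
        unfolding scale_sum_left using P(2) by (intro sum.cong) auto
      have "P z = scale (1 - (\<Sum>j=1..<m - 1. c j) + z0) (u 1)"
        using m3 Psum by (simp add: z_def linD[OF P(1)] P(2) scale_left_distrib scale_left_diff_distrib)
      then have Pz: "P z = 0" by (simp add: z0_def)
      have Qz: "Q z = z"
      proof -
        have "Q z = z - (\<Sum>j=1..<m - 1. scale (c j) (Q (u j))) + scale z0 (Q (u 0))"
          using Q(2)[of "m - 1"] m3 by (simp add: z_def linD[OF Q(1)])
        also have "(\<Sum>j=1..<m - 1. scale (c j) (Q (u j))) = 0"
          using Q(2) by (intro sum.neutral) auto
        finally show ?thesis using Q(2)[of 0] m3 by simp
      qed
      have Wu0: "W (u 0) = 0" using W(2)[of 0] m3 by (simp add: wf_def)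
      have nil: "(W ^^ (m - 2 + 2)) (u (Suc j) - u j) = 0" if "j \<le> m - 2" for j
      proof (rule chain_nilpotent[OF W(1) _ _ that, of "\<lambda>j. u (Suc j) - u j"])
        show "W (u (Suc i) - u i) = u (Suc (Suc i)) - u (Suc i)" if "i < m - 2" for i
          using that m3 W(2)[of i] W(2)[of "Suc i"] by (auto simp: linD[OF W(1)] wf_def)
        have "Suc (m - 2) = m - 1" using m3 by simp
        then have "W (u (Suc (m - 2)) - u (m - 2)) = scale (c 0 + z0) (u 0)"
          using m3 W(2)[of "m - 2"] W(2)[of "m - 1"] by (auto simp: linD[OF W(1)] wf_def w_def)
        then show "W (W (u (Suc (m - 2)) - u (m - 2))) = 0"
          by (simp add: linD[OF W(1)] Wu0)
      qed
      have nil': "(W ^^ m) (u j) = 0" if "j < m" for j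
        using that
      proof (induction j)
        case 0
        have "(W ^^ Suc 0) (u 0) = 0" using Wu0 by simp
        then show ?case by (rule pow_zero_mono[OF W(1)]) (use m in simp)
      next
        case (Suc j)
        have "u (Suc j) = u j + (u (Suc j) - u j)" by simp
        then have "(W ^^ m) (u (Suc j)) = (W ^^ m) (u j) + (W ^^ m) (u (Suc j) - u j)"
          by (metis linD(1)[OF lin_pow[OF W(1)]])
        moreover have "m - 2 + 2 = m" using m3 by simp
        ultimately show ?case using Suc nil[of j] m3 by (simp only:) simp
      qed
      have "B (u j) = P (u j) - Q (u j) + W (u j)" if "j < m" for j
      proof (cases "j = m - 1")
        case True
        then show ?thesis using P(2)[OF that] Q(2)[OF that] W(2)[OF that] last m3 y
          by (simp add: wf_def w_def z_def y_def scale_left_distrib)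
      next
        case False
        then show ?thesis using P(2)[OF that] Q(2)[OF that] W(2)[OF that] step[of j] that
          by (auto simp: wf_def)
      qed
      moreover have "W (u j) \<in> ?U" if "j < m" for j
        using W(2)[OF that] zU that m3 uU[of "Suc j"] uU[of 1]
        by (auto simp: wf_def intro!: span_diff span_zero)
      ultimately show ?thesis
        using P Q W(1) Pz Qz nil' zU m3 uU[of 1] span_zero
        by (intro concl[of P Q W m]) (auto simp: linD[OF P(1)] linD[OF Q(1)])
    qed
  qed
qed


text \<open>
  Induction on the size of the range of the projection $p$.  A vector $v \<noteq> 0$ in the range generates
  a $B$-invariant subspace $U$, spanned by the vectors $B^j v$ before the first linear
  dependence.  With a projection $\<rho>$ onto $U$ and $q = p - \<rho>$, the map $B$ is block triangular:
  $B = B \<rho> + q B q + \<rho> B q$.  The first summand is a companion block, the second is covered by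
  the induction hypothesis, and the third goes into the nilpotent part, where it does no harm because
  $q$ annihilates its range.
  
  Finiteness of the range replaces a dimension count: it ends the sequence $B^j v$, and its size
  drops from $p$ to $q$.
\<close>
lemma projected_decomposition:
  assumes p: "lin p" "\<And>x. p (p x) = p x" "finite (range p)"
    and B: "lin B" "\<And>x. B (p x) = B x" "\<And>x. p (B x) = B x"
  shows "\<exists>P Q W. lin P \<and> lin Q \<and> lin W \<and>
    (\<forall>x. P (p x) = P x \<and> p (P x) = P x \<and> Q (p x) = Q x \<and> p (Q x) = Q x \<and> W (p x) = W x \<and> p (W x) = W x) \<and>
    (\<forall>x. P (P x) = P x \<and> Q (Q x) = Q x \<and> P (Q x) = 0 \<and> Q (P x) = 0 \<and> B x = P x - Q x + W x) \<and>
    (\<exists>N. \<forall>x. (W ^^ N) (p x) = 0)"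
  using assms
proof (induction "card (range p)" arbitrary: p B rule: less_induct)
  case less
  note p = less.prems(1-3) and B = less.prems(4-6)
  have zero: "lin (\<lambda>_. 0)" by (rule linI) auto
  show ?case
  proof (cases "\<forall>x. p x = 0")
    case True
    have "B x = 0" for x using B(2)[of x] True linD(3)[OF B(1)] by simp
    then show ?thesis
      using True zero linD(3)[OF B(1)]
      by (intro exI[of _ "\<lambda>_. 0"] conjI allI) (auto intro!: exI[of _ 0])
  next
    case False
    then obtain v where v: "p v = v" "v \<noteq> 0" using p(2) by metis
    define u where "u = (\<lambda>j. (B ^^ j) v)"
    have u0: "u 0 = v" and uS: "u (Suc j) = B (u j)" for j by (auto simp: u_def)
    have pu: "p (u j) = u j" for j by (cases j) (auto simp: u0 uS v B)
    have ur: "u j \<in> range p" for j by (metis pu rangeI)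
    have "\<exists>m. u m \<in> span (u ` {..<m})"
    proof (rule ccontr)
      assume no: "\<nexists>m. u m \<in> span (u ` {..<m})"
      have "u i \<noteq> u j" if "i < j" for i j
        using no that by (metis image_eqI lessThan_iff span_base)
      then have "inj u" by (metis injI linorder_neqE_nat)
      then have "infinite (range u)" by (rule range_inj_infinite)
      then show False using ur p(3) by (meson finite_subset image_subsetI)
    qed
    define m where "m = (LEAST m. u m \<in> span (u ` {..<m}))"
    have um: "u m \<in> span (u ` {..<m})" unfolding m_def by (rule LeastI_ex) fact
    have notin: "u j \<notin> span (u ` {..<j})" if "j < m" for j
      using that not_less_Least unfolding m_def by blast
    have m: "0 < m" using um v u0 by (cases m) auto
    have "k \<le> m \<Longrightarrow> independent (u ` {..<k}) \<and> inj_on u {..<k}" for k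
    proof (induction k)
      case (Suc k)
      then have IH: "independent (u ` {..<k})" "inj_on u {..<k}" and ni: "u k \<notin> span (u ` {..<k})"
        using notin[of k] by auto
      have "u k \<notin> u ` {..<k}" by (rule contrapos_nn[OF ni]) (rule span_base)
      then show ?case using IH independent_insertI[OF ni IH(1)] by (simp add: lessThan_Suc)
    qed (simp add: independent_empty)
    then have indep: "independent (u ` {..<m})" "inj_on u {..<m}" by auto
    let ?U = "span (u ` {..<m})"
    obtain c' where "u m = (\<Sum>x\<in>u ` {..<m}. scale (c' x) x)"
      using um span_finite[of "u ` {..<m}"] by auto
    then have "u m = (\<Sum>j<m. scale (c' (u j)) (u j))"
      by (simp add: sum.reindex[OF indep(2)])
    then have last: "B (u (m - 1)) = (\<Sum>j<m. scale (c' (u j)) (u j))"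
      using uS[of "m - 1"] m by simp
    obtain P0 Q0 W0 N0 where lin0: "lin P0" "lin Q0" "lin W0"
      and blk: "\<And>j. j < m \<Longrightarrow> P0 (u j) \<in> ?U \<and> Q0 (u j) \<in> ?U \<and> W0 (u j) \<in> ?U \<and>
        P0 (P0 (u j)) = P0 (u j) \<and> Q0 (Q0 (u j)) = Q0 (u j) \<and> P0 (Q0 (u j)) = 0 \<and> Q0 (P0 (u j)) = 0 \<and>
        B (u j) = P0 (u j) - Q0 (u j) + W0 (u j)"
      and N0: "\<And>j. j < m \<Longrightarrow> (W0 ^^ N0) (u j) = 0"
      using cyclic_block_decomposition[OF B(1) m indep uS[symmetric] last] by blast
    interpret pr: vector_space_pair scale scale by unfold_locales
    have comp: "lin (\<lambda>x. f (g x))" if "lin f" "lin g" for f g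
      using that by (auto intro!: linI simp: linD)
    have lin_diff: "lin (\<lambda>x. f x - g x)" if "lin f" "lin g" for f g
      using that by (auto intro!: linI simp: linD scale_right_diff_distrib)
    have lin_plus: "lin (\<lambda>x. f x + g x)" if "lin f" "lin g" for f g
      using that by (auto intro!: linI simp: linD scale_right_distrib)
    have eqU: "f x = g x" if "lin f" "lin g" "\<And>j. j < m \<Longrightarrow> f (u j) = g (u j)" "x \<in> ?U" for f g x
      using pr.linear_eq_on_span[OF that(1,2) _ that(4)] that(3) by auto
    have inU: "f x \<in> ?U" if f: "lin f" "\<And>j. j < m \<Longrightarrow> f (u j) \<in> ?U" and x: "x \<in> ?U" for f x
      using x
    proof (induction rule: span_induct)
      case base
      show "subspace {x. f x \<in> ?U}"
        using f(1) by (auto simp: subspace_def linD span_zero span_add span_scale)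
    next
      case (step x)
      then show ?case using f(2) by auto
    qed
    have blkU: "P0 x \<in> ?U" "Q0 x \<in> ?U" "W0 x \<in> ?U"
      "P0 (P0 x) = P0 x" "Q0 (Q0 x) = Q0 x" "P0 (Q0 x) = 0" "Q0 (P0 x) = 0"
      "B x = P0 x - Q0 x + W0 x" "(W0 ^^ N0) x = 0" if x: "x \<in> ?U" for x
    proof -
      show "P0 x \<in> ?U" "Q0 x \<in> ?U" "W0 x \<in> ?U"
        using inU[OF lin0(1) _ x] inU[OF lin0(2) _ x] inU[OF lin0(3) _ x] blk by auto
      show "P0 (P0 x) = P0 x" by (rule eqU[OF comp[OF lin0(1,1)] lin0(1) _ x]) (use blk in blast)
      show "Q0 (Q0 x) = Q0 x" by (rule eqU[OF comp[OF lin0(2,2)] lin0(2) _ x]) (use blk in blast)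
      show "P0 (Q0 x) = 0" by (rule eqU[OF comp[OF lin0(1,2)] zero _ x]) (use blk in blast)
      show "Q0 (P0 x) = 0" by (rule eqU[OF comp[OF lin0(2,1)] zero _ x]) (use blk in blast)
      show "B x = P0 x - Q0 x + W0 x"
        by (rule eqU[OF B(1) lin_plus[OF lin_diff[OF lin0(1,2)] lin0(3)] _ x]) (use blk in blast)
      show "(W0 ^^ N0) x = 0"
        by (rule eqU[OF lin_pow[OF lin0(3)] zero _ x]) (use N0 in blast)
    qed
    obtain \<rho>0 where \<rho>0: "lin \<rho>0" "\<And>j. j < m \<Longrightarrow> \<rho>0 (u j) = u j" "\<And>x. \<rho>0 x \<in> ?U"
    proof -
      obtain g where "lin g" "\<forall>x\<in>u ` {..<m}. g x = id x" "range g = span (id ` (u ` {..<m}))"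
        using pr.linear_independent_extend_subspace[OF indep(1), of id] by blast
      then show thesis using that[of g] by auto
    qed
    have \<rho>0U: "\<rho>0 x = x" if "x \<in> ?U" for x
      using eqU[OF \<rho>0(1) linI[of "\<lambda>x. x"] _ that] \<rho>0(2) by simp
    have pU: "p x = x" if "x \<in> ?U" for x
      using eqU[OF p(1) linI[of "\<lambda>x. x"] _ that] pu by simp
    define \<rho> where "\<rho> = (\<lambda>x. \<rho>0 (p x))"
    have \<rho>: "lin \<rho>" "\<And>x. \<rho> x \<in> ?U" "\<And>x. x \<in> ?U \<Longrightarrow> \<rho> x = x" "\<And>x. \<rho> (p x) = \<rho> x" "\<And>x. p (\<rho> x) = \<rho> x"
      using comp[OF \<rho>0(1) p(1)] \<rho>0(3) \<rho>0U pU p(2) by (auto simp: \<rho>_def)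
    define q where "q = (\<lambda>x. p x - \<rho> x)"
    have linq: "lin q" unfolding q_def by (rule lin_diff[OF p(1) \<rho>(1)])
    have qU: "q x = 0" if "x \<in> ?U" for x using that by (simp add: q_def pU \<rho>(3))
    have qp: "q (p x) = q x" "p (q x) = q x" for x
      by (simp_all add: q_def p(2) \<rho> linD[OF p(1)])
    have \<rho>q: "\<rho> (q x) = 0" for x
      using \<rho>(2)[of x] by (simp add: q_def linD[OF \<rho>(1)] \<rho>)
    have qq: "q (q x) = q x" for x
      using qp(2)[of x] \<rho>q[of x] by (simp add: q_def)
    have "range q \<subseteq> range p" using qp(2) by (metis image_subsetI rangeI)
    moreover have "v \<in> range p" using v by (metis rangeI)
    moreover have "v \<notin> range q"
    proof
      assume "v \<in> range q"
      then have "q v = v" using qq by auto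
      moreover have "v \<in> ?U" using m u0 by (auto intro!: span_base image_eqI[of _ u 0])
      ultimately show False using qU v(2) by auto
    qed
    ultimately have small: "card (range q) < card (range p)" "finite (range q)"
      using p(3) by (auto intro!: psubset_card_mono intro: finite_subset)
    define B' where "B' = (\<lambda>x. q (B (q x)))"
    have B': "lin B'" "\<And>x. B' (q x) = B' x" "\<And>x. q (B' x) = B' x"
      unfolding B'_def using qq by (simp_all add: comp[OF linq comp[OF B(1) linq]])
    from less.hyps[OF small(1) linq qq small(2) B'] obtain P1 Q1 W1 N1 where
      lin1: "lin P1" "lin Q1" "lin W1"
      and q1': "\<forall>x. P1 (q x) = P1 x \<and> q (P1 x) = P1 x \<and> Q1 (q x) = Q1 x \<and> q (Q1 x) = Q1 x \<and>
        W1 (q x) = W1 x \<and> q (W1 x) = W1 x"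
      and id1': "\<forall>x. P1 (P1 x) = P1 x \<and> Q1 (Q1 x) = Q1 x \<and> P1 (Q1 x) = 0 \<and> Q1 (P1 x) = 0 \<and>
        B' x = P1 x - Q1 x + W1 x"
      and N1': "\<forall>x. (W1 ^^ N1) (q x) = 0"
      by (elim exE conjE)
    have N1: "(W1 ^^ N1) (q x) = 0" for x using N1' by blast
    have q1: "P1 (q x) = P1 x" "q (P1 x) = P1 x" "Q1 (q x) = Q1 x" "q (Q1 x) = Q1 x"
        "W1 (q x) = W1 x" "q (W1 x) = W1 x" for x
      using q1' by auto
    have id1: "P1 (P1 x) = P1 x" "Q1 (Q1 x) = Q1 x" "P1 (Q1 x) = 0" "Q1 (P1 x) = 0"
        "B' x = P1 x - Q1 x + W1 x" for x
      using id1' by auto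
    have kill1: "P1 x = 0" "Q1 x = 0" "W1 x = 0" if "x \<in> ?U" for x
      using q1(1)[of x] q1(3)[of x] q1(5)[of x] qU[OF that] linD(3)[OF lin1(1)] linD(3)[OF lin1(2)] linD(3)[OF lin1(3)]
      by auto
    have \<rho>1: "\<rho> (P1 x) = 0" "\<rho> (Q1 x) = 0" "\<rho> (W1 x) = 0" for x
      using \<rho>q[of "P1 x"] \<rho>q[of "Q1 x"] \<rho>q[of "W1 x"] q1 by auto
    define P where "P = (\<lambda>x. P0 (\<rho> x) + P1 x)"
    define Q where "Q = (\<lambda>x. Q0 (\<rho> x) + Q1 x)"
    define W where "W = (\<lambda>x. W0 (\<rho> x) + W1 x + \<rho> (B (q x)))"
    have lins: "lin P" "lin Q" "lin W"
      unfolding P_def Q_def W_def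
      using comp[OF lin0(1) \<rho>(1)] comp[OF lin0(2) \<rho>(1)] comp[OF lin0(3) \<rho>(1)] comp[OF \<rho>(1) comp[OF B(1) linq]]
      by (simp_all add: lin_plus lin1)
    have blk\<rho>: "P0 (\<rho> x) \<in> ?U" "Q0 (\<rho> x) \<in> ?U" "W0 (\<rho> x) \<in> ?U" for x
      using blkU(1-3)[OF \<rho>(2)] by auto
    have \<rho>PQW: "\<rho> (P x) = P0 (\<rho> x)" "\<rho> (Q x) = Q0 (\<rho> x)" "\<rho> (W x) = W0 (\<rho> x) + \<rho> (B (q x))" for x
      by (simp_all add: P_def Q_def W_def linD[OF \<rho>(1)] \<rho>1 \<rho>(2,3) blk\<rho>)
    have one: "P1 (P x) = P1 x" "P1 (Q x) = 0" "Q1 (P x) = 0" "Q1 (Q x) = Q1 x" for x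
      by (simp_all add: P_def Q_def linD[OF lin1(1)] linD[OF lin1(2)] kill1 blk\<rho> id1)
    have p1: "P1 (p x) = P1 x" "p (P1 x) = P1 x" "Q1 (p x) = Q1 x" "p (Q1 x) = Q1 x" "W1 (p x) = W1 x" "p (W1 x) = W1 x" for x
      using q1 qp by metis+
    have pinv: "P (p x) = P x" "p (P x) = P x" "Q (p x) = Q x" "p (Q x) = Q x" "W (p x) = W x" "p (W x) = W x" for x
      by (simp_all add: P_def Q_def W_def \<rho> p1 qp linD[OF p(1)] pU blk\<rho>)
    have PQd: "P y = P0 (\<rho> y) + P1 y" "Q y = Q0 (\<rho> y) + Q1 y" for y
      by (simp_all add: P_def Q_def)
    have idem: "P (P x) = P x" "Q (Q x) = Q x" "P (Q x) = 0" "Q (P x) = 0" for x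
      unfolding PQd(1)[of "P x"] PQd(2)[of "Q x"] PQd(1)[of "Q x"] PQd(2)[of "P x"] \<rho>PQW one
      by (simp_all add: blkU[OF \<rho>(2)] PQd)
    have sum: "B x = P x - Q x + W x" for x
    proof -
      have px: "p x = \<rho> x + q x" for x by (simp add: q_def)
      have "B x = B (\<rho> x) + B (q x)"
        using B(2)[of x] px[of x] linD(1)[OF B(1)] by metis
      also have "B (q x) = \<rho> (B (q x)) + q (B (q x))"
        using px[of "B (q x)"] B(3) by simp
      also have "q (B (q x)) = P1 x - Q1 x + W1 x" using id1(5)[of x] by (simp add: B'_def)
      also have "B (\<rho> x) = P0 (\<rho> x) - Q0 (\<rho> x) + W0 (\<rho> x)" by (rule blkU(8)[OF \<rho>(2)])
      finally show ?thesis by (simp add: P_def Q_def W_def algebra_simps)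
    qed
    have qW: "q ((W ^^ k) x) = (W1 ^^ k) (q x)" for k x
    proof (induction k)
      case (Suc k)
      have "q (W y) = W1 (q y)" for y
        using \<rho>(2) blk\<rho> by (simp add: W_def linD[OF linq] qU q1)
      then show ?case using Suc by simp
    qed simp
    have pW: "p ((W ^^ k) (p x)) = (W ^^ k) (p x)" for k x
      by (cases k) (auto simp: p pinv)
    have WU: "(W ^^ k) x = (W0 ^^ k) x \<and> (W0 ^^ k) x \<in> ?U" if "x \<in> ?U" for k x
    proof (induction k)
      case (Suc k)
      then show ?case
        using blkU(3)[of "(W0 ^^ k) x"] linD(3)[OF B(1)] linD(3)[OF \<rho>(1)]
        by (auto simp: W_def \<rho>(3) kill1 qU)
    qed (use that in simp)
    \<comment> \<open>First $q W = W_1 q$ drives the vector into $U$, then $W$ acts on $U$ as $W_0$ does.\<close>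
    have "(W ^^ (N0 + N1)) (p x) = 0" for x
    proof -
      define y where "y = (W ^^ N1) (p x)"
      have "q y = 0" using qW[of N1 "p x"] N1[of "p x"] by (simp add: y_def)
      moreover have "p y = y" using pW by (simp add: y_def)
      ultimately have "y = \<rho> y" by (simp add: q_def)
      then have "y \<in> ?U" using \<rho>(2) by metis
      then have "(W ^^ N0) y = 0" using WU blkU(9) by simp
      then show ?thesis by (simp add: funpow_add y_def)
    qed
    then have nil: "\<exists>N. \<forall>x. (W ^^ N) (p x) = 0" by blast
    show ?thesis
      by (rule exI[of _ P], rule exI[of _ Q], rule exI[of _ W])
         (intro conjI allI lins pinv idem sum nil)
  qed
qed

end

section \<open>Matrices over the fields with two and three elements\<close>

lemma coeff_sum_monom: "coeff (\<Sum>i<n. monom (f i) i) k = (if k < n then f k else 0)"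
  by (simp add: coeff_sum sum.delta if_distrib cong: if_cong)

text \<open>
  The decomposition of linear maps, with $n$-dimensional space realised as the polynomials of degree
  below $n$, a subspace cut out by a projection, so that the dimension is not tied to a type.
\<close>
lemma small_field_matrix_decomposition:
  fixes A :: "'k::field mat"
  assumes tri: "\<And>x :: 'k. x = 0 \<or> x = 1 \<or> x = - 1" and A: "A \<in> carrier_mat n n"
  shows "\<exists>P\<in>carrier_mat n n. \<exists>Q\<in>carrier_mat n n. \<exists>W\<in>carrier_mat n n.
    P * P = P \<and> Q * Q = Q \<and> P * Q = 0\<^sub>m n n \<and> Q * P = 0\<^sub>m n n \<and>
    (\<exists>N. W ^\<^sub>m N = 0\<^sub>m n n) \<and> A = P - Q + W"
proof -
  interpret small_field_space "smult :: 'k \<Rightarrow> 'k poly \<Rightarrow> 'k poly"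
    by unfold_locales (auto simp: smult_add_right smult_add_left tri)
  have finK: "finite (UNIV :: 'k set)"
    by (rule finite_subset[of _ "{0, 1, - 1}"]) (use tri in auto)
  \<comment> \<open>$pr$ truncates a polynomial to degree below $n$; $B$ is the endomorphism with matrix $A$.\<close>
  define pr :: "'k poly \<Rightarrow> 'k poly" where "pr = (\<lambda>p. \<Sum>i<n. monom (coeff p i) i)"
  define B where "B = (\<lambda>p. \<Sum>i<n. monom (\<Sum>j<n. A $$ (i, j) * coeff p j) i)"
  have cpr: "coeff (pr p) k = (if k < n then coeff p k else 0)" for p k
    unfolding pr_def by (rule coeff_sum_monom)
  have cB: "coeff (B p) k = (if k < n then \<Sum>j<n. A $$ (k, j) * coeff p j else 0)" for p k
    unfolding B_def by (rule coeff_sum_monom)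
  have prlin: "lin pr"
    by (rule linI; rule poly_eqI) (auto simp: cpr)
  have Blin: "lin B"
    by (rule linI; rule poly_eqI) (auto simp: cB algebra_simps sum.distrib sum_distrib_left)
  have prpr: "pr (pr p) = pr p" and Bpr: "B (pr p) = B p" and prB: "pr (B p) = B p" for p
    by (rule poly_eqI; simp add: cpr cB)+
  have "range pr \<subseteq> (\<lambda>f. \<Sum>i<n. monom (f i) i) ` ({..<n} \<rightarrow>\<^sub>E UNIV)"
  proof
    fix q assume "q \<in> range pr"
    then obtain p where "q = pr p" by blast
    then have "q = (\<Sum>i<n. monom (restrict (coeff p) {..<n} i) i)" by (simp add: pr_def)
    then show "q \<in> (\<lambda>f. \<Sum>i<n. monom (f i) i) ` ({..<n} \<rightarrow>\<^sub>E UNIV)"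
      by (rule image_eqI[where f = "\<lambda>f. \<Sum>i<n. monom (f i) i"]) (auto simp: PiE_def extensional_def)
  qed
  then have fin: "finite (range pr)"
    by (rule finite_subset) (intro finite_imageI finite_PiE finite_lessThan finK)
  obtain P Q W N where lin: "lin P" "lin Q" "lin W"
    and inv: "\<forall>x. P (pr x) = P x \<and> pr (P x) = P x \<and> Q (pr x) = Q x \<and> pr (Q x) = Q x \<and>
      W (pr x) = W x \<and> pr (W x) = W x"
    and eqs: "\<forall>x. P (P x) = P x \<and> Q (Q x) = Q x \<and> P (Q x) = 0 \<and> Q (P x) = 0 \<and> B x = P x - Q x + W x"
    and nil: "\<forall>x. (W ^^ N) (pr x) = 0"
    using projected_decomposition[OF prlin prpr fin Blin Bpr prB] by (elim exE conjE)
  define mt where "mt = (\<lambda>f :: 'k poly \<Rightarrow> 'k poly. mat n n (\<lambda>(i, j). coeff (f (monom 1 j)) i))"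
  have mt_car: "mt f \<in> carrier_mat n n" for f by (simp add: mt_def)
  have mt_cong: "mt f = mt g" if "\<And>x. f (pr x) = g (pr x)" for f g
  proof -
    have "pr (monom 1 j) = monom 1 j" if "j < n" for j
      by (rule poly_eqI) (use that in \<open>auto simp: cpr\<close>)
    then have "f (monom 1 j) = g (monom 1 j)" if "j < n" for j
      using \<open>\<And>x. f (pr x) = g (pr x)\<close>[of "monom 1 j"] that by simp
    then show ?thesis by (intro eq_matI) (auto simp: mt_def)
  qed
  have mt_mult: "mt (\<lambda>x. f (g x)) = mt f * mt g" if f: "lin f" and g: "\<And>x. pr (g x) = g x" for f g
  proof (rule eq_matI)
    fix i j assume ij: "i < dim_row (mt f * mt g)" "j < dim_col (mt f * mt g)"
    let ?c = "\<lambda>k. coeff (g (monom 1 j)) k"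
    have "g (monom 1 j) = (\<Sum>k<n. smult (?c k) (monom 1 k))"
      using g[of "monom 1 j"] by (simp add: pr_def smult_monom)
    then have "f (g (monom 1 j)) = f (\<Sum>k<n. smult (?c k) (monom 1 k))"
      by (rule arg_cong)
    also have "\<dots> = (\<Sum>k<n. smult (?c k) (f (monom 1 k)))"
      by (simp only: linD(2,6)[OF f])
    finally have "coeff (f (g (monom 1 j))) i = (\<Sum>k<n. coeff (f (monom 1 k)) i * ?c k)"
      by (simp add: coeff_sum mult.commute)
    then show "mt (\<lambda>x. f (g x)) $$ (i, j) = (mt f * mt g) $$ (i, j)"
      using ij by (simp add: mt_def scalar_prod_def atLeast0LessThan)
  qed (simp_all add: mt_def)
  have mt_pow: "mt (W ^^ k) = mt W ^\<^sub>m k" for k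
  proof (induction k)
    case 0
    then show ?case by (intro eq_matI) (auto simp: mt_def)
  next
    case (Suc k)
    have "mt (W ^^ Suc k) = mt (\<lambda>x. (W ^^ k) (W x))"
      by (simp add: funpow_Suc_right o_def del: funpow.simps)
    also have "\<dots> = mt (W ^^ k) * mt W"
      using inv by (intro mt_mult lin_pow lin(3)) auto
    finally show ?case using Suc by (simp del: funpow.simps)
  qed
  have zero: "mt (\<lambda>_. 0) = 0\<^sub>m n n" by (intro eq_matI) (auto simp: mt_def)
  have "mt P * mt P = mt P" "mt Q * mt Q = mt Q" "mt P * mt Q = 0\<^sub>m n n" "mt Q * mt P = 0\<^sub>m n n"
    using inv eqs lin by (simp_all add: zero flip: mt_mult)
  moreover have "mt W ^\<^sub>m N = 0\<^sub>m n n"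
    using mt_cong[of "W ^^ N" "\<lambda>_. 0"] nil by (simp add: zero flip: mt_pow)
  moreover have "A = mt P - mt Q + mt W"
  proof (rule eq_matI)
    fix i j assume "i < dim_row (mt P - mt Q + mt W)" "j < dim_col (mt P - mt Q + mt W)"
    then have ij: "i < n" "j < n" by (simp_all add: mt_def)
    have "coeff (B (monom 1 j)) i = A $$ (i, j)"
      using ij by (simp add: cB if_distrib[of "\<lambda>x. _ * x"] cong: if_cong)
    then show "A $$ (i, j) = (mt P - mt Q + mt W) $$ (i, j)"
      using ij eqs by (simp add: mt_def)
  qed (use A in \<open>simp_all add: mt_def\<close>)
  ultimately show ?thesis using mt_car by blast
qed

datatype gf3 = Zero3 | One3 | Two3

instantiation gf3 :: field
begin

fun plus_gf3 where
  "plus_gf3 Zero3 y = y" | "plus_gf3 x Zero3 = x"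
| "plus_gf3 One3 One3 = Two3" | "plus_gf3 Two3 Two3 = One3"
| "plus_gf3 One3 Two3 = Zero3" | "plus_gf3 Two3 One3 = Zero3"

fun times_gf3 where
  "times_gf3 Zero3 y = Zero3" | "times_gf3 One3 y = y"
| "times_gf3 Two3 Zero3 = Zero3" | "times_gf3 Two3 One3 = Two3" | "times_gf3 Two3 Two3 = One3"

fun uminus_gf3 where
  "uminus_gf3 Zero3 = Zero3" | "uminus_gf3 One3 = Two3" | "uminus_gf3 Two3 = One3"

definition "zero_gf3 = Zero3"
definition "one_gf3 = One3"
definition "minus_gf3 x y = x + - (y :: gf3)"
definition "inverse_gf3 x = (x :: gf3)"
definition "divide_gf3 x y = x * inverse (y :: gf3)"

instance
proof
  fix a b c :: gf3
  show "a * b * c = a * (b * c)" by (cases a; cases b; cases c) auto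
  show "a * b = b * a" by (cases a; cases b) auto
  show "1 * a = a" by (simp add: one_gf3_def)
  show "a + b + c = a + (b + c)" by (cases a; cases b; cases c) auto
  show "a + b = b + a" by (cases a; cases b) auto
  show "0 + a = a" by (simp add: zero_gf3_def)
  show "- a + a = 0" by (cases a) (auto simp: zero_gf3_def)
  show "a - b = a + - b" by (rule minus_gf3_def)
  show "(a + b) * c = a * c + b * c" by (cases a; cases b; cases c) auto
  show "(0::gf3) \<noteq> 1" by (simp add: zero_gf3_def one_gf3_def)
  show "a \<noteq> 0 \<Longrightarrow> inverse a * a = 1"
    by (cases a) (auto simp: zero_gf3_def one_gf3_def inverse_gf3_def)
  show "a div b = a * inverse b" by (rule divide_gf3_def)
  show "inverse (0::gf3) = 0" by (simp add: inverse_gf3_def)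
qed

end

lemma gf3_cases: "x = 0 \<or> x = 1 \<or> x = (- 1 :: gf3)"
  by (cases x) (auto simp: zero_gf3_def one_gf3_def)

lemma bit_cases: "x = 0 \<or> x = 1 \<or> x = (- 1 :: bit)"
  by (cases x) auto

section \<open>Matrices over rings with $a^3 = a$\<close>

text \<open>
  The tripotent part is kept as a difference of two orthogonal idempotents, because idempotents lift
  modulo every nil ideal, whatever the characteristic.
\<close>
definition orth_idem_plus_nil :: "('a, 'b) ring_scheme \<Rightarrow> 'a \<Rightarrow> bool" where
  "orth_idem_plus_nil M a \<longleftrightarrow> (\<exists>p\<in>carrier M. \<exists>q\<in>carrier M. \<exists>w.
     p \<otimes>\<^bsub>M\<^esub> p = p \<and> q \<otimes>\<^bsub>M\<^esub> q = q \<and> p \<otimes>\<^bsub>M\<^esub> q = \<zero>\<^bsub>M\<^esub> \<and> q \<otimes>\<^bsub>M\<^esub> p = \<zero>\<^bsub>M\<^esub> \<and>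
     ring_nilpotent M w \<and> a = (p \<ominus>\<^bsub>M\<^esub> q) \<oplus>\<^bsub>M\<^esub> w)"

context ring
begin

lemma nilpotent_add_orthogonal:
  assumes "ring_nilpotent R x" "ring_nilpotent R y" "x \<otimes> y = \<zero>" "y \<otimes> x = \<zero>"
  shows "ring_nilpotent R (x \<oplus> y)"
proof -
  obtain k l :: nat where [simp]: "x \<in> carrier R" "y \<in> carrier R" and kl: "x [^] k = \<zero>" "y [^] l = \<zero>"
    using assms(1,2) by (metis nilpotentE)
  have "(x \<oplus> y) [^] Suc m = x [^] Suc m \<oplus> y [^] Suc m" for m :: nat
  proof (induction m)
    case (Suc m)
    have "(x \<oplus> y) [^] Suc (Suc m) = (x [^] Suc m \<oplus> y [^] Suc m) \<otimes> (x \<oplus> y)"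
      using Suc by simp
    then show ?case using assms(3,4) by (simp add: l_distr r_distr m_assoc)
  qed simp
  moreover have "x [^] Suc (k + l) = x [^] k \<otimes> x [^] Suc l" "y [^] Suc (k + l) = y [^] l \<otimes> y [^] Suc k"
    using nat_pow_mult[of x k "Suc l"] nat_pow_mult[of y l "Suc k"]
    by (simp_all add: add.commute del: nat_pow_Suc)
  ultimately have "(x \<oplus> y) [^] Suc (k + l) = \<zero>"
    by (simp add: kl del: nat_pow_Suc)
  then show ?thesis by (intro nilpotentI[of _ "Suc (k + l)"]) simp_all
qed

text \<open>
  Multiplying the decompositions of $a$ and $b$ by $e$ and $f$ places them into two ideals that
  annihilate each other, where they can be added term by term.
\<close>
lemma orth_idem_plus_nil_add:
  assumes "orth_idem_plus_nil R a" "orth_idem_plus_nil R b"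
    and [simp]: "e \<in> carrier R" "f \<in> carrier R"
    and e: "e \<otimes> e = e" "\<And>x. x \<in> carrier R \<Longrightarrow> x \<otimes> e = e \<otimes> x"
    and f: "f \<otimes> f = f" "\<And>x. x \<in> carrier R \<Longrightarrow> x \<otimes> f = f \<otimes> x"
    and ef: "e \<otimes> f = \<zero>" and ea: "e \<otimes> a = a" and fb: "f \<otimes> b = b"
  shows "orth_idem_plus_nil R (a \<oplus> b)"
proof -
  obtain p q w where [simp]: "p \<in> carrier R" "q \<in> carrier R" "w \<in> carrier R"
    and pq: "p \<otimes> p = p" "q \<otimes> q = q" "p \<otimes> q = \<zero>" "q \<otimes> p = \<zero>"
    and w: "ring_nilpotent R w" and a: "a = (p \<ominus> q) \<oplus> w"
    using assms(1) unfolding orth_idem_plus_nil_def by (auto simp: ring_nilpotent_def)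
  obtain p' q' w' where [simp]: "p' \<in> carrier R" "q' \<in> carrier R" "w' \<in> carrier R"
    and pq': "p' \<otimes> p' = p'" "q' \<otimes> q' = q'" "p' \<otimes> q' = \<zero>" "q' \<otimes> p' = \<zero>"
    and w': "ring_nilpotent R w'" and b: "b = (p' \<ominus> q') \<oplus> w'"
    using assms(2) unfolding orth_idem_plus_nil_def by (auto simp: ring_nilpotent_def)
  have fe: "f \<otimes> e = \<zero>" using e(2)[of f] ef by simp
  have move: "x \<otimes> (e \<otimes> z) = e \<otimes> (x \<otimes> z)" "x \<otimes> (f \<otimes> z) = f \<otimes> (x \<otimes> z)"
    if "x \<in> carrier R" "z \<in> carrier R" for x z
    using that e(2)[of x] f(2)[of x] by (metis m_assoc \<open>e \<in> _\<close> \<open>f \<in> _\<close>)+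
  have prods: "(e \<otimes> x) \<otimes> (e \<otimes> z) = e \<otimes> (x \<otimes> z)" "(f \<otimes> x) \<otimes> (f \<otimes> z) = f \<otimes> (x \<otimes> z)"
    "(e \<otimes> x) \<otimes> (f \<otimes> z) = \<zero>" "(f \<otimes> x) \<otimes> (e \<otimes> z) = \<zero>"
    if "x \<in> carrier R" "z \<in> carrier R" for x z
  proof -
    have "(u \<otimes> x) \<otimes> (v \<otimes> z) = (u \<otimes> v) \<otimes> (x \<otimes> z)" if "v = e \<or> v = f" "u \<in> carrier R" for u v
      using that \<open>x \<in> _\<close> \<open>z \<in> _\<close> move[of x z] by (auto simp: m_assoc)
    then show "(e \<otimes> x) \<otimes> (e \<otimes> z) = e \<otimes> (x \<otimes> z)" "(f \<otimes> x) \<otimes> (f \<otimes> z) = f \<otimes> (x \<otimes> z)"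
      "(e \<otimes> x) \<otimes> (f \<otimes> z) = \<zero>" "(f \<otimes> x) \<otimes> (e \<otimes> z) = \<zero>"
      using that by (simp_all add: e(1) f(1) ef fe)
  qed
  define P where "P = e \<otimes> p \<oplus> f \<otimes> p'"
  define Q where "Q = e \<otimes> q \<oplus> f \<otimes> q'"
  define V where "V = e \<otimes> w \<oplus> f \<otimes> w'"
  have "ring_nilpotent R (e \<otimes> w)" "ring_nilpotent R (f \<otimes> w')"
    using nilpotent_mult_commuting[OF w, of e] nilpotent_mult_commuting[OF w', of f]
    by (simp_all add: e(2)[symmetric] f(2)[symmetric])
  then have "ring_nilpotent R V"
    unfolding V_def by (rule nilpotent_add_orthogonal) (simp_all add: prods)
  moreover have "P \<otimes> P = P" "Q \<otimes> Q = Q" "P \<otimes> Q = \<zero>" "Q \<otimes> P = \<zero>"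
    by (simp_all add: P_def Q_def l_distr r_distr prods pq pq')
  moreover have "a \<oplus> b = (P \<ominus> Q) \<oplus> V"
  proof -
    have "a \<oplus> b = e \<otimes> ((p \<ominus> q) \<oplus> w) \<oplus> f \<otimes> ((p' \<ominus> q') \<oplus> w')"
      using ea fb a b by simp
    then show ?thesis
      by (simp add: P_def Q_def V_def minus_eq r_distr r_minus minus_add a_ac)
  qed
  ultimately show ?thesis
    unfolding orth_idem_plus_nil_def by (intro bexI[of _ P] bexI[of _ Q] exI[of _ V]) (simp_all add: P_def Q_def)
qed

end

lemma matrix_ring_carrierI:
  assumes "A \<in> carrier_mat n n" "\<And>i j. i < n \<Longrightarrow> j < n \<Longrightarrow> A $$ (i, j) \<in> carrier R"
  shows "A \<in> carrier (matrix_ring R n)"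
  using assms by (simp add: matrix_ring_mem)

context ring
begin

text \<open>
  The map $\<phi>$ need not preserve $1$: it will send $1$ to a central idempotent $e$ of characteristic
  $2$ or $3$ and identify the field with a subring of $e R$.
\<close>
lemma map_field_matrix_decomposition:
  fixes \<phi> :: "'k::field \<Rightarrow> 'a"
  assumes tri: "\<And>x :: 'k. x = 0 \<or> x = 1 \<or> x = - 1"
    and [simp]: "\<And>x. \<phi> x \<in> carrier R"
    and add: "\<And>x y. \<phi> (x + y) = \<phi> x \<oplus> \<phi> y" and mult: "\<And>x y. \<phi> (x * y) = \<phi> x \<otimes> \<phi> y"
    and A: "A \<in> carrier_mat n n"
  shows "orth_idem_plus_nil (matrix_ring R n) (map_mat \<phi> A)"
proof -
  let ?M = "matrix_ring R n"
  interpret M: ring ?M by (rule ring_matrix_ring[OF ring_axioms])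
  obtain P Q W N where car: "P \<in> carrier_mat n n" "Q \<in> carrier_mat n n" "W \<in> carrier_mat n n"
    and PQ: "P * P = P" "Q * Q = Q" "P * Q = 0\<^sub>m n n" "Q * P = 0\<^sub>m n n"
    and W: "W ^\<^sub>m N = 0\<^sub>m n n" and AP: "A = P - Q + W"
    using small_field_matrix_decomposition[OF tri A] by auto
  have zero: "\<phi> 0 = \<zero>"
    using add[of 0 0] by (metis add.l_cancel_one' add_0 assms(2))
  have sum: "\<phi> (\<Sum>k<m. g k) = (\<Oplus>k\<in>{..<m}. \<phi> (g k))" for m :: nat and g
    by (induction m) (simp_all add: zero add lessThan_Suc a_comm)
  have clos: "map_mat \<phi> B \<in> carrier ?M" if "B \<in> carrier_mat n n" for B
    using that by (intro matrix_ring_carrierI) auto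
  have hmult: "map_mat \<phi> (B * C) = map_mat \<phi> B \<otimes>\<^bsub>?M\<^esub> map_mat \<phi> C"
    if "B \<in> carrier_mat n n" "C \<in> carrier_mat n n" for B C
  proof (rule matrix_ring_eqI[of _ R n])
    fix i j assume ij: "i < n" "j < n"
    have "map_mat \<phi> (B * C) $$ (i, j) = (\<Oplus>k\<in>{..<n}. \<phi> (B $$ (i, k)) \<otimes> \<phi> (C $$ (k, j)))"
      using that ij by (simp add: scalar_prod_def atLeast0LessThan sum mult)
    also have "\<dots> = (\<Oplus>k\<in>{..<n}. map_mat \<phi> B $$ (i, k) \<otimes> map_mat \<phi> C $$ (k, j))"
      using that ij by (intro finsum_cong') auto
    finally show "map_mat \<phi> (B * C) $$ (i, j) = (map_mat \<phi> B \<otimes>\<^bsub>?M\<^esub> map_mat \<phi> C) $$ (i, j)"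
      using ij by (simp add: matrix_ring_index)
  qed (use that clos in simp_all)
  have hadd: "map_mat \<phi> (B + C) = map_mat \<phi> B \<oplus>\<^bsub>?M\<^esub> map_mat \<phi> C"
    if "B \<in> carrier_mat n n" "C \<in> carrier_mat n n" for B C
    using that clos by (intro matrix_ring_eqI[of _ R n]) (auto simp: matrix_ring_index add)
  have hzero: "map_mat \<phi> (0\<^sub>m n n) = \<zero>\<^bsub>?M\<^esub>"
    using clos by (intro matrix_ring_eqI[of _ R n]) (auto simp: matrix_ring_index zero)
  have hdiff: "map_mat \<phi> (P - Q) = map_mat \<phi> P \<ominus>\<^bsub>?M\<^esub> map_mat \<phi> Q"
  proof -
    have sub: "P - Q \<in> carrier_mat n n" by (rule minus_carrier_mat[OF car(2)])
    have "(P - Q) + Q = P" using car by (intro eq_matI) auto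
    then have "map_mat \<phi> P = map_mat \<phi> (P - Q) \<oplus>\<^bsub>?M\<^esub> map_mat \<phi> Q"
      using hadd[OF sub car(2)] by simp
    then show ?thesis using clos[OF sub] clos[OF car(2)]
      by (simp add: M.minus_eq M.a_assoc M.r_neg)
  qed
  \<comment> \<open>Positive exponents only, since $\<phi>$ need not send $1$ to $1$.\<close>
  have pow: "map_mat \<phi> (W ^\<^sub>m Suc k) = map_mat \<phi> W [^]\<^bsub>?M\<^esub> Suc k" for k
  proof (induction k)
    case 0
    have "W ^\<^sub>m Suc 0 = W" using car by simp
    then show ?case using car clos by simp
  next
    case (Suc k)
    have "map_mat \<phi> (W ^\<^sub>m Suc k * W) = map_mat \<phi> (W ^\<^sub>m Suc k) \<otimes>\<^bsub>?M\<^esub> map_mat \<phi> W"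
      using car by (intro hmult) (auto intro!: pow_carrier_mat)
    then show ?case using Suc by simp
  qed
  have "W ^\<^sub>m Suc N = 0\<^sub>m n n" using W car by simp
  then have "ring_nilpotent ?M (map_mat \<phi> W)"
    using pow[of N] car clos by (intro M.nilpotentI[of _ "Suc N"]) (simp_all add: hzero)
  moreover have "map_mat \<phi> A = (map_mat \<phi> P \<ominus>\<^bsub>?M\<^esub> map_mat \<phi> Q) \<oplus>\<^bsub>?M\<^esub> map_mat \<phi> W"
    using hadd[OF minus_carrier_mat[OF car(2)] car(3)] AP by (simp add: hdiff)
  moreover note hmult[of P P] hmult[of Q Q] hmult[of P Q] hmult[of Q P]
  ultimately show ?thesis
    unfolding orth_idem_plus_nil_def using car clos PQ hzero
    by (intro bexI[of _ "map_mat \<phi> P"] bexI[of _ "map_mat \<phi> Q"] exI[of _ "map_mat \<phi> W"]) auto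
qed

definition scalar_matrix :: "nat \<Rightarrow> 'a \<Rightarrow> 'a mat" where
  "scalar_matrix n e = mat n n (\<lambda>(i, j). if i = j then e else \<zero>)"

lemma scalar_matrix_closed: "e \<in> carrier R \<Longrightarrow> scalar_matrix n e \<in> carrier (matrix_ring R n)"
  by (auto simp: scalar_matrix_def matrix_ring_mem)

lemma scalar_matrix_mult:
  assumes e: "e \<in> carrier R" and A: "A \<in> carrier (matrix_ring R n)" and ij: "i < n" "j < n"
  shows "(scalar_matrix n e \<otimes>\<^bsub>matrix_ring R n\<^esub> A) $$ (i, j) = e \<otimes> A $$ (i, j)"
    and "(A \<otimes>\<^bsub>matrix_ring R n\<^esub> scalar_matrix n e) $$ (i, j) = A $$ (i, j) \<otimes> e"
proof -
  have ent: "A $$ (k, l) \<in> carrier R" if "k < n" "l < n" for k l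
    using A that by (simp add: matrix_ring_mem)
  have "(\<Oplus>k\<in>{..<n}. scalar_matrix n e $$ (i, k) \<otimes> A $$ (k, j)) =
      (\<Oplus>k\<in>{..<n}. if i = k then e \<otimes> A $$ (k, j) else \<zero>)"
    using ij ent e by (intro finsum_cong') (auto simp: scalar_matrix_def)
  also have "\<dots> = e \<otimes> A $$ (i, j)"
    using ij ent e by (intro finsum_singleton) auto
  finally show "(scalar_matrix n e \<otimes>\<^bsub>matrix_ring R n\<^esub> A) $$ (i, j) = e \<otimes> A $$ (i, j)"
    using ij by (simp add: matrix_ring_index)
  have "(\<Oplus>k\<in>{..<n}. A $$ (i, k) \<otimes> scalar_matrix n e $$ (k, j)) =
      (\<Oplus>k\<in>{..<n}. if j = k then A $$ (i, k) \<otimes> e else \<zero>)"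
    using ij ent e by (intro finsum_cong') (auto simp: scalar_matrix_def)
  also have "\<dots> = A $$ (i, j) \<otimes> e"
    using ij ent e by (intro finsum_singleton) auto
  finally show "(A \<otimes>\<^bsub>matrix_ring R n\<^esub> scalar_matrix n e) $$ (i, j) = A $$ (i, j) \<otimes> e"
    using ij by (simp add: matrix_ring_index)
qed

lemma central_split_decomposition:
  assumes A: "A \<in> carrier (matrix_ring R n)"
    and [simp]: "e \<in> carrier R" "f \<in> carrier R"
    and e: "e \<otimes> e = e" "\<And>x. x \<in> carrier R \<Longrightarrow> x \<otimes> e = e \<otimes> x"
    and f: "f \<otimes> f = f" "\<And>x. x \<in> carrier R \<Longrightarrow> x \<otimes> f = f \<otimes> x"
    and ef: "e \<otimes> f = \<zero>"
    and dec: "orth_idem_plus_nil (matrix_ring R n) (scalar_matrix n e \<otimes>\<^bsub>matrix_ring R n\<^esub> A)"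
      "orth_idem_plus_nil (matrix_ring R n) (scalar_matrix n f \<otimes>\<^bsub>matrix_ring R n\<^esub> A)"
  shows "orth_idem_plus_nil (matrix_ring R n) (scalar_matrix n (e \<oplus> f) \<otimes>\<^bsub>matrix_ring R n\<^esub> A)"
proof -
  let ?M = "matrix_ring R n" and ?s = "scalar_matrix n"
  interpret M: ring ?M by (rule ring_matrix_ring[OF ring_axioms])
  note [simp] = scalar_matrix_closed A
  have ent: "B $$ (i, j) \<in> carrier R" if "B \<in> carrier ?M" "i < n" "j < n" for B i j
    using that by (simp add: matrix_ring_mem)
  have ss: "?s x \<otimes>\<^bsub>?M\<^esub> ?s y = ?s (x \<otimes> y)" if "x \<in> carrier R" "y \<in> carrier R" for x y
    using that by (intro matrix_ring_eqI[of _ R n]) (auto simp: scalar_matrix_mult, auto simp: scalar_matrix_def)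
  have central: "B \<otimes>\<^bsub>?M\<^esub> ?s x = ?s x \<otimes>\<^bsub>?M\<^esub> B"
    if "B \<in> carrier ?M" "x \<in> carrier R" "\<And>y. y \<in> carrier R \<Longrightarrow> y \<otimes> x = x \<otimes> y" for B x
    using that by (intro matrix_ring_eqI[of _ R n]) (auto simp: scalar_matrix_mult ent)
  have zero: "?s \<zero> = \<zero>\<^bsub>?M\<^esub>"
    by (intro matrix_ring_eqI[of _ R n]) (auto simp: matrix_ring_index, auto simp: scalar_matrix_def)
  have "?s (e \<oplus> f) \<otimes>\<^bsub>?M\<^esub> A = (?s e \<otimes>\<^bsub>?M\<^esub> A) \<oplus>\<^bsub>?M\<^esub> (?s f \<otimes>\<^bsub>?M\<^esub> A)"
    by (intro matrix_ring_eqI[of _ R n]) (auto simp: matrix_ring_index(1) scalar_matrix_mult ent l_distr)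
  also have "orth_idem_plus_nil ?M \<dots>"
  proof (rule M.orth_idem_plus_nil_add[OF dec, of "?s e" "?s f"])
    show "B \<otimes>\<^bsub>?M\<^esub> ?s e = ?s e \<otimes>\<^bsub>?M\<^esub> B" "B \<otimes>\<^bsub>?M\<^esub> ?s f = ?s f \<otimes>\<^bsub>?M\<^esub> B"
      if "B \<in> carrier ?M" for B
      using central[OF that _ e(2)] central[OF that _ f(2)] by auto
    show "?s e \<otimes>\<^bsub>?M\<^esub> (?s e \<otimes>\<^bsub>?M\<^esub> A) = ?s e \<otimes>\<^bsub>?M\<^esub> A" "?s f \<otimes>\<^bsub>?M\<^esub> (?s f \<otimes>\<^bsub>?M\<^esub> A) = ?s f \<otimes>\<^bsub>?M\<^esub> A"
      by (simp_all add: ss e(1) f(1) flip: M.m_assoc)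
  qed (simp_all add: ss e(1) f(1) ef zero)
  finally show ?thesis .
qed


lemma cube_eq_square_zero:
  assumes cube: "\<And>a. a \<in> carrier R \<Longrightarrow> a \<otimes> a \<otimes> a = a" and "x \<in> carrier R" "x \<otimes> x = \<zero>"
  shows "x = \<zero>"
  using cube[of x] assms by simp

text \<open>
  Both $e r (1 - e)$ and $(1 - e) r e$ square to zero.
\<close>
lemma cube_eq_idempotent_central:
  assumes cube: "\<And>a. a \<in> carrier R \<Longrightarrow> a \<otimes> a \<otimes> a = a"
    and [simp]: "e \<in> carrier R" "r \<in> carrier R" and ee: "e \<otimes> e = e"
  shows "r \<otimes> e = e \<otimes> r"
proof -
  have ee': "e \<otimes> (e \<otimes> z) = e \<otimes> z" if "z \<in> carrier R" for z
    using that ee by (simp flip: m_assoc)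
  have "e \<otimes> r \<ominus> e \<otimes> (r \<otimes> e) = \<zero>"
    by (rule cube_eq_square_zero[OF cube])
       (simp_all add: minus_eq l_distr r_distr l_minus r_minus m_assoc ee ee' minus_add a_ac r_neg r_neg1 r_neg2)
  moreover have "r \<otimes> e \<ominus> e \<otimes> (r \<otimes> e) = \<zero>"
    by (rule cube_eq_square_zero[OF cube])
       (simp_all add: minus_eq l_distr r_distr l_minus r_minus m_assoc ee ee' minus_add a_ac r_neg r_neg1 r_neg2)
  ultimately show ?thesis by (metis assms(2,3) m_closed r_right_minus_eq)
qed

text \<open>
  In such a ring $6 = 2^3 - 2 = 0$, so $1 = 3 + (-2)$ is a sum of orthogonal idempotents of
  characteristic $2$ and $3$.  A piece $e$ of characteristic $2$ or $3$ can be split further, by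
  idempotents that are polynomials in an entry $a$ of the matrix, into pieces on which $a$ equals $0$,
  $e$ or $-e$.  When this has been done for all entries, the matrix lives on each piece over a
  field with two or three elements, and the decompositions of the pieces can be added.
\<close>
lemma cube_eq_matrix_decomposition:
  assumes cube: "\<And>a. a \<in> carrier R \<Longrightarrow> a \<otimes> a \<otimes> a = a"
    and A: "A \<in> carrier (matrix_ring R n)"
  shows "orth_idem_plus_nil (matrix_ring R n) A"
proof -
  let ?M = "matrix_ring R n" and ?s = "scalar_matrix n"
  interpret M: ring ?M by (rule ring_matrix_ring[OF ring_axioms])
  have ent: "A $$ (i, j) \<in> carrier R" if "i < n" "j < n" for i j
    using A that by (simp add: matrix_ring_mem)
  note central = cube_eq_idempotent_central[OF cube]
  define dec where "dec = (\<lambda>e. orth_idem_plus_nil ?M (?s e \<otimes>\<^bsub>?M\<^esub> A))"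
  have join: "dec (e \<oplus> f)"
    if "e \<in> carrier R" "f \<in> carrier R" "e \<otimes> e = e" "f \<otimes> f = f" "e \<otimes> f = \<zero>" "dec e" "dec f" for e f
    using that central unfolding dec_def by (intro central_split_decomposition[OF A]) auto
  have char2: "dec e"
    if [simp]: "e \<in> carrier R" and ee: "e \<otimes> e = e" and e2: "e \<oplus> e = \<zero>"
      and vals: "\<And>i j. i < n \<Longrightarrow> j < n \<Longrightarrow> e \<otimes> A $$ (i, j) \<in> {\<zero>, e, \<ominus> e}" for e
  proof -
    define \<phi> where "\<phi> = (\<lambda>b :: bit. if b = 0 then \<zero> else e)"
    have "\<ominus> e = e" using e2 minus_equality[of e e] by simp
    then have vals': "e \<otimes> A $$ (i, j) \<in> {\<zero>, e}" if "i < n" "j < n" for i j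
      using vals[OF that] by auto
    define B where "B = mat n n (\<lambda>(i, j). if e \<otimes> A $$ (i, j) = \<zero> then 0 else 1 :: bit)"
    have "orth_idem_plus_nil ?M (map_mat \<phi> B)"
    proof (rule map_field_matrix_decomposition[OF bit_cases])
      show "\<phi> (x + y) = \<phi> x \<oplus> \<phi> y" "\<phi> (x * y) = \<phi> x \<otimes> \<phi> y" for x y
        by (cases x; cases y; simp add: \<phi>_def ee e2)+
    qed (auto simp: \<phi>_def B_def)
    moreover have "map_mat \<phi> B = ?s e \<otimes>\<^bsub>?M\<^esub> A"
    proof (rule matrix_ring_eqI[of _ R n])
      show "map_mat \<phi> B \<in> carrier ?M" by (rule matrix_ring_carrierI) (auto simp: B_def \<phi>_def)
      fix i j assume "i < n" "j < n"
      then show "map_mat \<phi> B $$ (i, j) = (?s e \<otimes>\<^bsub>?M\<^esub> A) $$ (i, j)"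
        using vals'[of i j] by (auto simp: scalar_matrix_mult[OF _ A] B_def \<phi>_def)
    qed (simp add: scalar_matrix_closed A)
    ultimately show ?thesis by (simp add: dec_def)
  qed
  have char3: "dec e"
    if [simp]: "e \<in> carrier R" and ee: "e \<otimes> e = e" and e3: "e \<oplus> e = \<ominus> e"
      and vals: "\<And>i j. i < n \<Longrightarrow> j < n \<Longrightarrow> e \<otimes> A $$ (i, j) \<in> {\<zero>, e, \<ominus> e}" for e
  proof -
    define \<phi> where "\<phi> = case_gf3 \<zero> e (\<ominus> e)"
    define B where "B = mat n n (\<lambda>(i, j). if e \<otimes> A $$ (i, j) = \<zero> then Zero3
      else if e \<otimes> A $$ (i, j) = e then One3 else Two3)"
    have e3': "\<ominus> e \<oplus> \<ominus> e = e" using e3 by (metis minus_add minus_minus that(1))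
    have "orth_idem_plus_nil ?M (map_mat \<phi> B)"
    proof (rule map_field_matrix_decomposition[OF gf3_cases])
      show "\<phi> (x + y) = \<phi> x \<oplus> \<phi> y" "\<phi> (x * y) = \<phi> x \<otimes> \<phi> y" for x y
        by (cases x; cases y; simp add: \<phi>_def ee e3 e3' l_minus r_minus l_neg r_neg)+
      show "\<phi> x \<in> carrier R" for x by (cases x) (auto simp: \<phi>_def)
    qed (auto simp: B_def)
    moreover have "map_mat \<phi> B = ?s e \<otimes>\<^bsub>?M\<^esub> A"
    proof (rule matrix_ring_eqI[of _ R n])
      show "map_mat \<phi> B \<in> carrier ?M" by (rule matrix_ring_carrierI) (auto simp: B_def \<phi>_def)
      fix i j assume "i < n" "j < n"
      then show "map_mat \<phi> B $$ (i, j) = (?s e \<otimes>\<^bsub>?M\<^esub> A) $$ (i, j)"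
        using vals[of i j] by (auto simp: scalar_matrix_mult[OF _ A] B_def \<phi>_def)
    qed (simp add: scalar_matrix_closed A)
    ultimately show ?thesis by (simp add: dec_def)
  qed
  \<comment> \<open>$D$ is the set of positions whose entries have not been made constant on the piece $e$.\<close>
  have all: "dec e"
    if "D \<subseteq> {..<n} \<times> {..<n}" "finite D" "e \<in> carrier R" "e \<otimes> e = e" "e \<oplus> e = \<zero> \<or> e \<oplus> e = \<ominus> e"
      "\<And>i j. i < n \<Longrightarrow> j < n \<Longrightarrow> (i, j) \<notin> D \<Longrightarrow> e \<otimes> A $$ (i, j) \<in> {\<zero>, e, \<ominus> e}" for D e
    using that(2,1,3-)
  proof (induction D arbitrary: e rule: finite_induct)
    case empty
    then show ?case using char2 char3 by auto
  next
    case (insert d D)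
    obtain i j where d: "d = (i, j)" "i < n" "j < n" using insert.prems(1) by auto
    define a where "a = A $$ (i, j)"
    have [simp]: "a \<in> carrier R" using ent d by (simp add: a_def)
    note [simp] = insert.prems(2)
    note ee = insert.prems(3)
    have ae: "a \<otimes> e = e \<otimes> a" by (rule central) (simp_all add: ee)
    define g where "g = e \<otimes> a"
    define f where "f = g \<otimes> a"
    have [simp]: "g \<in> carrier R" "f \<in> carrier R" by (simp_all add: g_def f_def)
    have eg: "e \<otimes> g = g" "g \<otimes> e = g" "e \<otimes> f = f" "f \<otimes> e = f"
      using ae ee by (simp_all add: g_def f_def m_assoc) (simp_all add: ee flip: m_assoc)
    have ga: "g \<otimes> a = f" by (simp add: f_def)
    have fa: "f \<otimes> a = g" using cube[of a] by (simp add: f_def g_def m_assoc)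
    have gg: "g \<otimes> g = f" "f \<otimes> g = g" "f \<otimes> f = f" "g \<otimes> f = g"
    proof -
      have "x \<otimes> g = x \<otimes> a" if "x \<otimes> e = x" "x \<in> carrier R" for x
        using that by (simp add: g_def flip: m_assoc)
      then show gg: "g \<otimes> g = f" and fg: "f \<otimes> g = g" using eg ga fa by auto
      have "g \<otimes> f = (g \<otimes> g) \<otimes> a" "f \<otimes> f = (f \<otimes> g) \<otimes> a"
        by (simp_all add: m_assoc ga)
      then show "g \<otimes> f = g" "f \<otimes> f = f" by (simp_all only: gg fg fa ga)
    qed
    have sub: "dec e'"
      if [simp]: "e' \<in> carrier R" and "e' \<otimes> e' = e'" and e'e: "e' \<otimes> e = e'" "e' \<otimes> a \<in> {\<zero>, e', \<ominus> e'}" for e'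
    proof (rule insert.IH)
      show "D \<subseteq> {..<n} \<times> {..<n}" using insert.prems(1) by simp
      have "e' \<otimes> (e \<oplus> e) = e' \<oplus> e'" "e' \<otimes> \<ominus> e = \<ominus> e'"
        using e'e by (simp_all add: r_distr r_minus)
      then show "e' \<oplus> e' = \<zero> \<or> e' \<oplus> e' = \<ominus> e'"
        using insert.prems(4) by auto
      fix k l assume kl: "k < n" "l < n" "(k, l) \<notin> D"
      show "e' \<otimes> A $$ (k, l) \<in> {\<zero>, e', \<ominus> e'}"
      proof (cases "(k, l) = d")
        case True
        then show ?thesis using e'e d by (simp add: a_def)
      next
        case False
        then have "e \<otimes> A $$ (k, l) \<in> {\<zero>, e, \<ominus> e}" using kl insert.prems(5) by auto
        moreover have "e' \<otimes> A $$ (k, l) = e' \<otimes> (e \<otimes> A $$ (k, l))"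
          using e'e ent[OF kl(1,2)] by (simp flip: m_assoc)
        ultimately show ?thesis using e'e by (auto simp: r_minus)
      qed
    qed (use that in auto)
    have dec_f: "dec f"
    proof (cases "e \<oplus> e = \<zero>")
      case True
      \<comment> \<open>In characteristic $2$ the element $f + g$ squares to zero, so $a$ acts on $f = e a^2$ as $1$.\<close>
      have "f \<oplus> f = \<zero>" "g \<oplus> g = \<zero>"
        using True eg by (metis l_distr l_null insert.prems(2) \<open>f \<in> _\<close> \<open>g \<in> _\<close>)+
      then have "(f \<oplus> g) \<otimes> (f \<oplus> g) = \<zero>"
        by (simp add: l_distr r_distr gg a_ac)
      then have "f \<oplus> g = \<zero>" using cube_eq_square_zero[OF cube, of "f \<oplus> g"] by simp
      then have "f \<otimes> a = \<ominus> f"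
        using minus_equality[of g f] a_comm[of f g] fa by simp
      then show ?thesis using eg gg by (intro sub) auto
    next
      case False
      then have "e \<oplus> e = \<ominus> e" using insert.prems(4) by simp
      then have f2: "x \<oplus> x = \<ominus> x" if "e \<otimes> x = x" "x \<in> carrier R" for x
        using that l_distr[of e e x] l_minus[of e x] by simp
      \<comment> \<open>In characteristic $3$ these are the idempotents $(f + g)/2$ and $(f - g)/2$, where $1/2 = -1$.\<close>
      define h1 where "h1 = \<ominus> (f \<oplus> g)"
      define h2 where "h2 = g \<ominus> f"
      have [simp]: "h1 \<in> carrier R" "h2 \<in> carrier R" by (simp_all add: h1_def h2_def)
      have eh: "e \<otimes> (f \<oplus> g) = f \<oplus> g" "e \<otimes> h2 = h2"
        by (simp_all add: h2_def minus_eq r_distr r_minus eg)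
      have "(f \<oplus> g) \<otimes> (f \<oplus> g) = (f \<oplus> g) \<oplus> (f \<oplus> g)"
        by (simp add: l_distr r_distr gg a_ac)
      then have h11: "h1 \<otimes> h1 = h1"
        using f2[OF eh(1)] by (simp add: h1_def l_minus r_minus)
      have gh: "g \<otimes> h2 = \<ominus> h2" "f \<otimes> h2 = h2"
        by (simp_all add: h2_def minus_eq r_distr r_minus gg minus_add a_comm)
      then have "h2 \<otimes> h2 = \<ominus> (h2 \<oplus> h2)"
        by (simp add: h2_def[unfolded minus_eq] l_distr l_minus minus_add)
      then have h22: "h2 \<otimes> h2 = h2"
        using f2[OF eh(2)] by simp
      have h12: "h1 \<otimes> h2 = \<zero>"
        by (simp add: h1_def l_minus l_distr gh r_neg)
      have h1a: "h1 \<otimes> a = h1" by (simp add: h1_def l_minus l_distr fa ga a_comm)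
      have h2a: "h2 \<otimes> a = \<ominus> h2" by (simp add: h2_def minus_eq l_minus l_distr fa ga minus_add a_comm)
      have he: "h1 \<otimes> e = h1" "h2 \<otimes> e = h2"
        by (simp_all add: h1_def h2_def minus_eq l_minus l_distr eg)
      have "dec (h1 \<oplus> h2)"
        using h11 h22 h12 h1a h2a he by (intro join sub) auto
      moreover have "h1 \<oplus> h2 = \<ominus> (f \<oplus> f)"
        by (simp add: h1_def h2_def minus_eq minus_add a_assoc r_neg1)
      then have "h1 \<oplus> h2 = f" using f2[OF eg(3)] by simp
      ultimately show ?thesis by simp
    qed
    define e0 where "e0 = e \<ominus> f"
    have [simp]: "e0 \<in> carrier R" by (simp add: e0_def)
    have "e0 \<otimes> a = \<zero>" using fa by (simp add: e0_def minus_eq l_distr l_minus g_def r_neg)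
    moreover have "e0 \<otimes> e0 = e0" "e0 \<otimes> e = e0" "e0 \<otimes> f = \<zero>"
      by (simp_all add: e0_def minus_eq l_distr r_distr l_minus r_minus eg gg ee r_neg l_neg)
    moreover from calculation have "dec e0" by (intro sub) auto
    ultimately have "dec (e0 \<oplus> f)"
      using dec_f gg(3) by (intro join) simp_all
    moreover have "e0 \<oplus> f = e" by (simp add: e0_def minus_eq a_assoc l_neg)
    ultimately show ?case by simp
  qed
  define D where "D = {..<n} \<times> {..<n}"
  define u where "u = \<one> \<oplus> \<one>"
  have [simp]: "u \<in> carrier R" by (simp add: u_def)
  have uu: "u \<otimes> x = x \<oplus> x" if "x \<in> carrier R" for x
    using that by (simp add: u_def l_distr)
  have "u \<oplus> (u \<oplus> (u \<oplus> u)) = u \<oplus> \<zero>"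
    using cube[of u] by (simp add: uu l_distr a_assoc)
  then have six: "u \<oplus> (u \<oplus> u) = \<zero>" by (simp only: add.l_cancel a_closed zero_closed \<open>u \<in> _\<close>)
  have u2: "u \<oplus> u = \<ominus> u"
    using minus_equality[of "u \<oplus> u" u] six by (simp add: a_ac)
  \<comment> \<open>$t = 3$ has characteristic $2$, and $s = -2$ has characteristic $3$.\<close>
  define t where "t = u \<oplus> \<one>"
  define s where "s = \<ominus> u"
  have [simp]: "t \<in> carrier R" "s \<in> carrier R" by (simp_all add: t_def s_def)
  have "t \<oplus> t = u \<oplus> (u \<oplus> (\<one> \<oplus> \<one>))" by (simp add: t_def a_ac)
  then have tt: "t \<oplus> t = \<zero>" using six by (simp add: u_def)
  have ss: "s \<oplus> s = \<ominus> s"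
    unfolding s_def using u2 minus_add[of u u] by simp
  have ut: "u \<otimes> t = \<zero>" using tt uu[of t] by simp
  have "t \<otimes> t = t" using ut l_distr[of u \<one> t] by (simp flip: t_def)
  moreover have "s \<otimes> s = s" by (simp add: s_def l_minus r_minus uu u2)
  moreover have "t \<otimes> s = \<zero>" using six by (simp add: t_def s_def l_distr r_minus uu a_assoc)
  moreover have "t \<oplus> s = \<one>" by (simp add: t_def s_def a_comm[of u \<one>] a_assoc r_neg)
  ultimately have dts: "t \<otimes> t = t" "s \<otimes> s = s" "t \<otimes> s = \<zero>" "t \<oplus> s = \<one>" by auto
  then have "dec (t \<oplus> s)"
    using tt ss by (intro join all[of D]) (auto simp: D_def)
  then have "dec \<one>" using dts by simp
  moreover have "?s \<one> = \<one>\<^bsub>?M\<^esub>" by (simp add: scalar_matrix_def matrix_ring_def)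
  ultimately show ?thesis using A by (simp add: dec_def)
qed

end

section \<open>Lifting modulo a nil kernel\<close>

context ring_hom_ring
begin

lemma idempotent_lift:
  assumes ker: "\<And>x. x \<in> carrier R \<Longrightarrow> h x = \<zero>\<^bsub>S\<^esub> \<Longrightarrow> ring_nilpotent R x"
    and [simp]: "x \<in> carrier R" and x: "h x \<otimes>\<^bsub>S\<^esub> h x = h x"
  obtains e s where "e \<in> carrier R" "s \<in> carrier R" "e \<otimes> e = e" "h e = h x" "e = x \<otimes> s" "e = s \<otimes> x"
proof -
  define c where "c = \<one> \<ominus> x"
  have [simp]: "c \<in> carrier R" by (simp add: c_def)
  have xc: "x \<oplus> c = \<one>" by (simp add: c_def R.minus_eq R.a_lcomm[of x \<one>] R.r_neg)
  have hxc: "h (x \<otimes> c) = \<zero>\<^bsub>S\<^esub>"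
    using x by (simp add: c_def R.minus_eq R.r_distr R.r_minus S.r_neg)
  then obtain k :: nat where "(x \<otimes> c) [^] k = \<zero>"
    using ker[of "x \<otimes> c"] by (auto elim: R.nilpotentE)
  from R.idempotent_lifting[OF _ _ xc this] obtain s d where [simp]: "s \<in> carrier R" "d \<in> carrier R"
    and com: "\<And>z. z \<in> carrier R \<Longrightarrow> z \<otimes> x = x \<otimes> z \<Longrightarrow> z \<otimes> s = s \<otimes> z"
    and idem: "(x \<otimes> s) \<otimes> (x \<otimes> s) = x \<otimes> s" and xd: "x = x \<otimes> s \<oplus> (x \<otimes> c) \<otimes> d"
    by auto
  have "h x = h (x \<otimes> s \<oplus> (x \<otimes> c) \<otimes> d)" using xd by simp
  also have "\<dots> = h (x \<otimes> s) \<oplus>\<^bsub>S\<^esub> h (x \<otimes> c) \<otimes>\<^bsub>S\<^esub> h d"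
    by (simp only: hom_add hom_mult R.m_closed \<open>x \<in> _\<close> \<open>s \<in> _\<close> \<open>c \<in> _\<close> \<open>d \<in> _\<close>)
  finally have "h (x \<otimes> s) = h x" using hxc by simp
  then show thesis using that[of "x \<otimes> s" s] idem com[of x] by simp
qed

text \<open>
  Lift $P$ to an idempotent $p$, cut a preimage of $Q$ down to the corner of $1 - p$, and lift the result
  to an idempotent $q$.  Since $q$ is a multiple, on both sides, of an element of that corner, it is
  orthogonal to $p$; hence $(p - q)^3 = p - q$.  The rest, $a - (p - q)$, maps to a nilpotent element and
  is therefore nilpotent.
\<close>
lemma tripotent_plus_nilpotent_lift:
  assumes surj: "\<And>c. c \<in> carrier S \<Longrightarrow> \<exists>x\<in>carrier R. h x = c"
    and ker: "\<And>x. x \<in> carrier R \<Longrightarrow> h x = \<zero>\<^bsub>S\<^esub> \<Longrightarrow> ring_nilpotent R x"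
    and [simp]: "a \<in> carrier R" and dec: "orth_idem_plus_nil S (h a)"
  shows "\<exists>e w. ring_tripotent R e \<and> ring_nilpotent R w \<and> a = e \<oplus> w"
proof -
  obtain P Q W where [simp]: "P \<in> carrier S" "Q \<in> carrier S"
    and PQ: "P \<otimes>\<^bsub>S\<^esub> P = P" "Q \<otimes>\<^bsub>S\<^esub> Q = Q" "P \<otimes>\<^bsub>S\<^esub> Q = \<zero>\<^bsub>S\<^esub>" "Q \<otimes>\<^bsub>S\<^esub> P = \<zero>\<^bsub>S\<^esub>"
    and W: "ring_nilpotent S W" and ha: "h a = (P \<ominus>\<^bsub>S\<^esub> Q) \<oplus>\<^bsub>S\<^esub> W"
    using dec unfolding orth_idem_plus_nil_def by blast
  have [simp]: "W \<in> carrier S" using W by (simp add: ring_nilpotent_def)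
  obtain p0 where p0: "p0 \<in> carrier R" "h p0 = P" using surj[of P] by auto
  then obtain p where [simp]: "p \<in> carrier R" and p: "p \<otimes> p = p" "h p = P"
    using idempotent_lift[OF ker p0(1)] PQ(1) by metis
  obtain q0 where q0: "q0 \<in> carrier R" "h q0 = Q" using surj[of Q] by auto
  note [simp] = q0(1)
  define u where "u = \<one> \<ominus> p"
  have [simp]: "u \<in> carrier R" by (simp add: u_def)
  have pu: "p \<otimes> u = \<zero>" "u \<otimes> p = \<zero>"
    by (simp_all add: u_def R.minus_eq R.r_distr R.l_distr R.r_minus R.l_minus p R.r_neg)
  define q1 where "q1 = u \<otimes> (q0 \<otimes> u)"
  have [simp]: "q1 \<in> carrier R" by (simp add: q1_def)
  have hq1: "h q1 = Q"
    by (simp add: q1_def u_def R.minus_eq S.l_distr S.r_distr S.l_minus S.r_minus p q0 PQ)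
  obtain q s where [simp]: "q \<in> carrier R" "s \<in> carrier R"
    and q: "q \<otimes> q = q" "h q = Q" "q = q1 \<otimes> s" "q = s \<otimes> q1"
    using idempotent_lift[OF ker, of q1] hq1 PQ(2) by (metis \<open>q1 \<in> carrier R\<close>)
  have "p \<otimes> q1 = (p \<otimes> u) \<otimes> (q0 \<otimes> u)" "q1 \<otimes> p = u \<otimes> (q0 \<otimes> (u \<otimes> p))"
    by (simp_all add: q1_def R.m_assoc)
  then have pq1: "p \<otimes> q1 = \<zero>" "q1 \<otimes> p = \<zero>" by (simp_all add: pu)
  have "p \<otimes> q = (p \<otimes> q1) \<otimes> s" using q(3) by (simp add: R.m_assoc)
  then have pq: "p \<otimes> q = \<zero>" by (simp add: pq1)
  have "q \<otimes> p = s \<otimes> (q1 \<otimes> p)" using q(4) by (simp add: R.m_assoc)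
  then have qp: "q \<otimes> p = \<zero>" by (simp add: pq1)
  define e where "e = p \<ominus> q"
  define w where "w = a \<ominus> e"
  have [simp]: "e \<in> carrier R" "w \<in> carrier R" by (simp_all add: e_def w_def)
  have "e \<otimes> e = p \<oplus> q"
    by (simp add: e_def R.minus_eq R.l_distr R.r_distr R.l_minus R.r_minus p q(1) pq qp)
  then have "e \<otimes> e \<otimes> e = e"
    by (simp add: e_def R.minus_eq R.l_distr R.r_distr R.l_minus R.r_minus p(1) q(1) pq qp)
  then have "ring_tripotent R e" by (simp add: ring_tripotent_def numeral_3_eq_3)
  moreover have "h w = W"
  proof -
    have "h w = h a \<ominus>\<^bsub>S\<^esub> (P \<ominus>\<^bsub>S\<^esub> Q)" by (simp add: w_def e_def hom_minus p(2) q(2))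
    also have "\<dots> = W"
      unfolding ha by (simp add: S.minus_eq[of "_ \<oplus>\<^bsub>S\<^esub> _"] S.a_comm[of "P \<ominus>\<^bsub>S\<^esub> Q"] S.a_assoc S.r_neg)
    finally show ?thesis .
  qed
  then obtain k :: nat where "h w [^]\<^bsub>S\<^esub> k = \<zero>\<^bsub>S\<^esub>"
    using W by (auto elim: S.nilpotentE)
  then have "h (w [^] k) = \<zero>\<^bsub>S\<^esub>" by (simp add: hom_nat_pow)
  then have "ring_nilpotent R w"
    using ker[of "w [^] k"] R.nilpotent_of_power[of w k] by simp
  moreover have "a = e \<oplus> w"
    by (simp add: w_def R.minus_eq R.a_lcomm[of e] R.r_neg)
  ultimately show ?thesis by blast
qed

lemma map_mat_ring_hom:
  "ring_hom_ring (matrix_ring R n) (matrix_ring S n) (map_mat h)"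
proof (rule ring_hom_ringI2)
  show "ring (matrix_ring R n)" "ring (matrix_ring S n)"
    by (intro ring_matrix_ring R.ring_axioms S.ring_axioms)+
  have closed: "map_mat h A \<in> carrier (matrix_ring S n)" if "A \<in> carrier (matrix_ring R n)" for A
    using that by (auto simp: matrix_ring_mem)
  interpret M: ring "matrix_ring R n" by (rule ring_matrix_ring[OF R.ring_axioms])
  interpret N: ring "matrix_ring S n" by (rule ring_matrix_ring[OF S.ring_axioms])
  have sum: "h (\<Oplus>k\<in>{..<m}. f k) = (\<Oplus>\<^bsub>S\<^esub>k\<in>{..<m}. h (f k))"
    if "\<And>k. k < m \<Longrightarrow> f k \<in> carrier R" for m :: nat and f
    using that
    by (induction m) (simp_all add: lessThan_Suc R.finsum_insert S.finsum_insert Pi_def)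
  show "map_mat h \<in> ring_hom (matrix_ring R n) (matrix_ring S n)"
  proof (rule ring_hom_memI)
    fix A B assume A: "A \<in> carrier (matrix_ring R n)" and B: "B \<in> carrier (matrix_ring R n)"
    then have dims: "A \<in> carrier_mat n n" "B \<in> carrier_mat n n"
      and ent: "\<And>i j. i < n \<Longrightarrow> j < n \<Longrightarrow> A $$ (i, j) \<in> carrier R" "\<And>i j. i < n \<Longrightarrow> j < n \<Longrightarrow> B $$ (i, j) \<in> carrier R"
      by (auto simp: matrix_ring_mem)
    have AB: "A \<otimes>\<^bsub>matrix_ring R n\<^esub> B \<in> carrier_mat n n" "A \<oplus>\<^bsub>matrix_ring R n\<^esub> B \<in> carrier_mat n n"
      using A B M.m_closed M.a_closed by (auto simp: matrix_ring_mem)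
    show "map_mat h (A \<otimes>\<^bsub>matrix_ring R n\<^esub> B) = map_mat h A \<otimes>\<^bsub>matrix_ring S n\<^esub> map_mat h B"
    proof (rule matrix_ring_eqI[of _ S n])
      fix i j assume ij: "i < n" "j < n"
      have "map_mat h (A \<otimes>\<^bsub>matrix_ring R n\<^esub> B) $$ (i, j) = h (\<Oplus>k\<in>{..<n}. A $$ (i, k) \<otimes> B $$ (k, j))"
        using ij AB by (simp add: matrix_ring_index)
      also have "\<dots> = (\<Oplus>\<^bsub>S\<^esub>k\<in>{..<n}. h (A $$ (i, k) \<otimes> B $$ (k, j)))"
        by (rule sum) (use ent ij in auto)
      also have "\<dots> = (\<Oplus>\<^bsub>S\<^esub>k\<in>{..<n}. map_mat h A $$ (i, k) \<otimes>\<^bsub>S\<^esub> map_mat h B $$ (k, j))"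
        using ent ij dims by (intro S.finsum_cong') auto
      finally show "map_mat h (A \<otimes>\<^bsub>matrix_ring R n\<^esub> B) $$ (i, j) =
          (map_mat h A \<otimes>\<^bsub>matrix_ring S n\<^esub> map_mat h B) $$ (i, j)"
        using ij by (simp add: matrix_ring_index)
    qed (use A B closed in simp_all)
    show "map_mat h (A \<oplus>\<^bsub>matrix_ring R n\<^esub> B) = map_mat h A \<oplus>\<^bsub>matrix_ring S n\<^esub> map_mat h B"
      using A B closed dims AB ent by (intro matrix_ring_eqI[of _ S n]) (auto simp: matrix_ring_index)
  next
    have "\<one>\<^bsub>matrix_ring R n\<^esub> \<in> carrier_mat n n" using M.one_closed by (simp add: matrix_ring_mem)
    then show "map_mat h \<one>\<^bsub>matrix_ring R n\<^esub> = \<one>\<^bsub>matrix_ring S n\<^esub>"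
      using closed[OF M.one_closed] by (intro matrix_ring_eqI[of _ S n]) (auto simp: matrix_ring_index)
  qed (rule closed)
qed

end

section \<open>Matrix rings over strongly 2-nil-clean rings\<close>

theorem theorem4p9:
  fixes R :: "('a, 'b) ring_scheme"
  assumes "ring R"
    and "bounded_index R"
    and "strongly_2_nil_clean R"
  shows "\<forall>n::nat. 1 \<le> n \<longrightarrow> trinil_clean (matrix_ring R n)"
proof (intro allI impI)
  fix n :: nat
  interpret R: ring R by fact
  note cube = R.strongly_2_nil_clean_cube[OF assms(3)]
  let ?J = "R.nil_radical" and ?S = "R Quot R.nil_radical" and ?h = "(+>\<^bsub>R\<^esub>) R.nil_radical"
  have mem_J: "x \<in> ?J \<longleftrightarrow> ring_nilpotent R x" for x
    by (rule R.nil_radical_eq_nilpotents[OF cube])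
  interpret J: ideal ?J R by (rule R.nil_radical_ideal[OF cube])
  interpret h: ring_hom_ring R ?S ?h by (rule J.rcos_ring_hom_ring)
  obtain k :: nat where k: "\<And>x. x \<in> ?J \<Longrightarrow> x [^]\<^bsub>R\<^esub> k = \<zero>\<^bsub>R\<^esub>"
    using assms(2) unfolding bounded_index_def mem_J by blast
  have cubeS: "c \<otimes>\<^bsub>?S\<^esub> c \<otimes>\<^bsub>?S\<^esub> c = c" if "c \<in> carrier ?S" for c
  proof -
    from that obtain x where [simp]: "x \<in> carrier R" and c: "c = ?h x"
      by (rule J.quotient_carrierE)
    have "?h (x \<otimes>\<^bsub>R\<^esub> x \<otimes>\<^bsub>R\<^esub> x \<ominus>\<^bsub>R\<^esub> x) = \<zero>\<^bsub>?S\<^esub>"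
      using cube[of x] J.quotient_zero_iff[of "x \<otimes>\<^bsub>R\<^esub> x \<otimes>\<^bsub>R\<^esub> x \<ominus>\<^bsub>R\<^esub> x"] by (simp add: mem_J)
    then show ?thesis by (simp add: h.hom_minus c)
  qed
  interpret H: ring_hom_ring "matrix_ring R n" "matrix_ring ?S n" "map_mat ?h"
    by (rule h.map_mat_ring_hom)
  show "trinil_clean (matrix_ring R n)"
    unfolding trinil_clean_def
  proof
    fix A assume A: "A \<in> carrier (matrix_ring R n)"
    show "\<exists>e w. ring_tripotent (matrix_ring R n) e \<and> ring_nilpotent (matrix_ring R n) w \<and>
        A = e \<oplus>\<^bsub>matrix_ring R n\<^esub> w"
    proof (rule H.tripotent_plus_nilpotent_lift[OF _ _ A])
      show "orth_idem_plus_nil (matrix_ring ?S n) (map_mat ?h A)"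
        using A by (intro h.S.cube_eq_matrix_decomposition cubeS) auto
    next
      fix C assume C: "C \<in> carrier (matrix_ring ?S n)"
      have "\<forall>i j. \<exists>x. i < n \<longrightarrow> j < n \<longrightarrow> x \<in> carrier R \<and> C $$ (i, j) = ?h x"
        using C J.quotient_carrierE by (metis matrix_ring_mem)
      then obtain f where f: "\<And>i j. i < n \<Longrightarrow> j < n \<Longrightarrow> f i j \<in> carrier R \<and> C $$ (i, j) = ?h (f i j)"
        by metis
      have B: "mat n n (\<lambda>(i, j). f i j) \<in> carrier (matrix_ring R n)"
        using f by (intro matrix_ring_carrierI) auto
      have "map_mat ?h (mat n n (\<lambda>(i, j). f i j)) = C"
        using H.hom_closed[OF B] C f by (intro matrix_ring_eqI[of _ ?S n]) auto
      with B show "\<exists>B\<in>carrier (matrix_ring R n). map_mat ?h B = C" by blast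
    next
      fix B assume B: "B \<in> carrier (matrix_ring R n)" and hB: "map_mat ?h B = \<zero>\<^bsub>matrix_ring ?S n\<^esub>"
      have "B $$ (i, j) \<in> ?J" if ij: "i < n" "j < n" for i j
      proof -
        have "?h (B $$ (i, j)) = map_mat ?h B $$ (i, j)" "B $$ (i, j) \<in> carrier R"
          using B ij by (auto simp: matrix_ring_mem)
        then show ?thesis
          using ij J.quotient_zero_iff[of "B $$ (i, j)"] by (simp add: hB matrix_ring_index)
      qed
      from R.nil_bounded_index_matrix_nilpotent[OF J.ideal_axioms k B this]
      show "ring_nilpotent (matrix_ring R n) B" .
    qed
  qed
qed

end
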